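(* Let $\mu^{[\infty]}$ be the Brownian fan with intensity $a>0$, and for $t>0$ let $N_t=\mu^{[\infty]}(\{w\in\mathcal{E}:\mathfrak{s}(w)<t<\mathfrak{e}(w)\})$ be the number of particles alive at time $t$. There exist a constant $C>0$ and a strictly positive, continuous, decreasing function $\lambda\colon\mathbb{R}_+\to\mathbb{R}_+$ such that $$\mathbf{E}\exp(\lambda_tN_t)\le C$$ holds uniformly over all $t>0$.
   Context: Excursions: triples $w=(s,t,y)$, $s\in\mathbb{R}$, $t\in\mathbb{R}\cup\{+\infty\}$, $s<t$, $y\in C(\mathbb{R},\mathbb{R})$ constant on $(-\infty,s]$ and on $[t,\infty)$; $\mathfrak{s}(w)=s$, $\mathfrak{e}(w)=t$, $w_\tau=y_\tau$; $\mathcal{E}$ is the set of excursions. $\mathbf{Q}$ is Itô's Brownian excursion measure on excursions starting at time $0$ from $0$, normalised as $\lim_{\varepsilon\to0}\varepsilon^{-1}$(law of Brownian motion from $\varepsilon$ killed at $0$), so that $\mathfrak{e}(w)$ has density $s^{-3/2}/\sqrt{2\pi}$ under $\mathbf{Q}$. $\Theta_{w,\tau}$ translates an excursion in time and space so that its starting point $(0,0)$ is moved to $(\tau,w_\tau)$. The kernel is $\mathcal{Q}(w,\cdot)=\frac a2\int_{\mathfrak{s}(w)}^{\mathfrak{e}(w)}\Theta_{w,\tau}^\star\mathbf{Q}\,d\tau$. The Brownian fan with intensity $a$ is $\mu^{[\infty]}=\sum_{n\ge0}\mu^n$, where $\mu^0=\delta_{w_0}$ with $w_0$ a Brownian motion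 started at $0$ at time $0$ and killed when it reaches level $-L$, $L$ an independent exponential random variable with mean $a$, and where, for $n\ge1$, conditionally on $\mu^0,\dots,\mu^{n-1}$, $\mu^n$ is a Poisson point process on $\mathcal{E}$ with intensity $\int\mathcal{Q}(w,\cdot)\,\mu^{n-1}(dw)$. *)

theory Defs
  imports "HOL-Probability.Probability"
begin

type_synonym exc = "real \<times> ereal \<times> (real \<Rightarrow> real)"

definition exc_start :: "exc \<Rightarrow> real" where "exc_start w = fst w"
definition exc_end :: "exc \<Rightarrow> ereal" where "exc_end w = fst (snd w)"
definition exc_path :: "exc \<Rightarrow> real \<Rightarrow> real" where "exc_path w = snd (snd w)"

definition Exc :: "exc set" where
  "Exc = {(s, t, y). ereal s < t \<and> continuous_on UNIV y \<and>
                     (\<forall>\<tau>. \<tau> \<le> s \<longrightarrow> y \<tau> = y s) \<and>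
                     (\<forall>\<tau>. t \<le> ereal \<tau> \<longrightarrow> y \<tau> = y (real_of_ereal t))}"

definition path_M :: "(real \<Rightarrow> real) measure" where
  "path_M = (\<Pi>\<^sub>M \<tau>\<in>UNIV. (borel :: real measure))"

definition exc_M :: "exc measure" where
  "exc_M = restrict_space ((borel :: real measure) \<Otimes>\<^sub>M ((borel :: ereal measure) \<Otimes>\<^sub>M path_M)) Exc"

text \<open>Independence of two random variables with possibly different value types
  (indep_var of the library requires equal types): independence of generated sigma-algebras.\<close>
definition indep_rv :: "'o measure \<Rightarrow> 'a measure \<Rightarrow> ('o \<Rightarrow> 'a) \<Rightarrow> 'b measure \<Rightarrow> ('o \<Rightarrow> 'b) \<Rightarrow> bool" where
  "indep_rv M Ma A Mb B \<longleftrightarrow> A \<in> measurable M Ma \<and> B \<in> measurable M Mb \<and>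
     prob_space.indep_set M (sets (vimage_algebra (space M) A Ma)) (sets (vimage_algebra (space M) B Mb))"

definition is_BM :: "'o measure \<Rightarrow> ('o \<Rightarrow> real \<Rightarrow> real) \<Rightarrow> real \<Rightarrow> bool" where
  "is_BM M X x \<longleftrightarrow> prob_space M \<and> X \<in> measurable M path_M \<and>
     (\<forall>\<omega>\<in>space M. continuous_on UNIV (X \<omega>) \<and> (\<forall>\<tau>. \<tau> \<le> 0 \<longrightarrow> X \<omega> \<tau> = x)) \<and>
     (\<forall>s t. 0 \<le> s \<longrightarrow> s < t \<longrightarrow>
        distributed M lborel (\<lambda>\<omega>. X \<omega> t - X \<omega> s) (normal_density 0 (sqrt (t - s))) \<and>
        indep_rv M (\<Pi>\<^sub>M r\<in>{..s}. (borel :: real measure)) (\<lambda>\<omega>. restrict (X \<omega>) {..s})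
                   (borel :: real measure) (\<lambda>\<omega>. X \<omega> t - X \<omega> s))"

definition hit_time :: "real \<Rightarrow> (real \<Rightarrow> real) \<Rightarrow> ereal" where
  "hit_time c y = (if {\<tau>. 0 \<le> \<tau> \<and> y \<tau> = c} = {} then \<infinity>
                   else ereal (Inf {\<tau>. 0 \<le> \<tau> \<and> y \<tau> = c}))"

definition kill :: "real \<Rightarrow> (real \<Rightarrow> real) \<Rightarrow> exc" where
  "kill c y = (0, hit_time c y,
               \<lambda>\<tau>. if ereal \<tau> \<le> hit_time c y then y \<tau> else y (real_of_ereal (hit_time c y)))"

definition heat :: "real \<Rightarrow> real \<Rightarrow> real" where
  "heat t x = exp (- x\<^sup>2 / (2 * t)) / sqrt (2 * pi * t)"

text \<open>Transition density of Brownian motion killed at 0.\<close>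
definition killed_heat :: "real \<Rightarrow> real \<Rightarrow> real \<Rightarrow> real" where
  "killed_heat t x y = heat t (x - y) - heat t (x + y)"

text \<open>Entrance law: n_t(dx) = lim eps^-1 P^eps(X_t in dx, T_0 > t) = 2x/t * heat t x dx.\<close>
definition entrance :: "real \<Rightarrow> real \<Rightarrow> real" where
  "entrance t x = 2 * x / t * heat t x"

fun chain :: "real \<Rightarrow> real \<Rightarrow> (real \<times> real set) list \<Rightarrow> ennreal" where
  "chain s x [] = 1"
| "chain s x ((t, B) # rest) =
     (\<integral>\<^sup>+ y. indicator (B \<inter> {0<..}) y * ennreal (killed_heat (t - s) x y) * chain t y rest \<partial>lborel)"

definition fdd_Q :: "(real \<times> real set) list \<Rightarrow> ennreal" where
  "fdd_Q tbs = (case tbs of [] \<Rightarrow> \<infinity>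
     | (t, B) # rest \<Rightarrow>
        (\<integral>\<^sup>+ y. indicator (B \<inter> {0<..}) y * ennreal (entrance t y) * chain t y rest \<partial>lborel))"

text \<open>Q is Ito's measure of positive Brownian excursions starting at time 0 from 0,
  normalised as lim eps^-1 (law of BM from eps killed at 0): its finite dimensional
  distributions (on the event that the excursion is alive at the observed times) are given by
  the entrance law and the killed heat kernel.\<close>
definition is_ito :: "exc measure \<Rightarrow> bool" where
  "is_ito Q \<longleftrightarrow> sets Q = sets exc_M \<and>
     (AE w in Q. exc_start w = 0 \<and> exc_end w < \<infinity> \<and>
        (\<forall>\<tau>. exc_path w \<tau> > 0 \<longleftrightarrow> (0 < \<tau> \<and> ereal \<tau> < exc_end w)) \<and>
        (\<forall>\<tau>. \<tau> \<le> 0 \<or> exc_end w \<le> ereal \<tau> \<longrightarrow> exc_path w \<tau> = 0)) \<and>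
     (\<forall>tbs. tbs \<noteq> [] \<longrightarrow> sorted_wrt (<) (map fst tbs) \<longrightarrow> 0 < fst (hd tbs) \<longrightarrow>
        (\<forall>tb\<in>set tbs. snd tb \<in> sets borel) \<longrightarrow>
        emeasure Q {w\<in>space exc_M. \<forall>tb\<in>set tbs. exc_path w (fst tb) \<in> snd tb \<and> 0 < exc_path w (fst tb)}
          = fdd_Q tbs)"

definition Theta :: "exc \<Rightarrow> real \<Rightarrow> exc \<Rightarrow> exc" where
  "Theta w \<tau> v = (exc_start v + \<tau>, exc_end v + ereal \<tau>, \<lambda>r. exc_path v (r - \<tau>) + exc_path w \<tau>)"

definition kern_int :: "real \<Rightarrow> exc measure \<Rightarrow> exc \<Rightarrow> (exc \<Rightarrow> ennreal) \<Rightarrow> ennreal" where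
  "kern_int a Q w g = ennreal (a / 2) *
     (\<integral>\<^sup>+ \<tau>. indicator {\<tau>. exc_start w < \<tau> \<and> ereal \<tau> < exc_end w} \<tau> *
               (\<integral>\<^sup>+ v. g (Theta w \<tau> v) \<partial>Q) \<partial>lborel)"

text \<open>A point configuration is given by its multiplicity function m; integral of f against it.\<close>
definition cint :: "(exc \<Rightarrow> nat) \<Rightarrow> (exc \<Rightarrow> ennreal) \<Rightarrow> ennreal" where
  "cint m f = (\<integral>\<^sup>+ w. of_nat (m w) * f w \<partial>count_space UNIV)"

definition cnt :: "(exc \<Rightarrow> nat) \<Rightarrow> exc set \<Rightarrow> ennreal" where
  "cnt m A = cint m (indicator A)"

definition enexp_neg :: "ennreal \<Rightarrow> ennreal" where
  "enexp_neg x = (if x = \<infinity> then 0 else ennreal (exp (- enn2real x)))"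

definition enexp_pos :: "real \<Rightarrow> ennreal \<Rightarrow> ennreal" where
  "enexp_pos c x = (if x = \<infinity> then \<infinity> else ennreal (exp (c * enn2real x)))"

definition gen_sigma :: "'o measure \<Rightarrow> (nat \<Rightarrow> 'o \<Rightarrow> exc \<Rightarrow> nat) \<Rightarrow> nat \<Rightarrow> 'o set set" where
  "gen_sigma M N n = sigma_sets (space M)
     {{\<omega>\<in>space M. cnt (N k \<omega>) A \<in> B} | k A B. k < n \<and> A \<in> sets exc_M \<and> B \<in> sets borel}"

definition is_brownian_fan ::
  "real \<Rightarrow> exc measure \<Rightarrow> 'o measure \<Rightarrow> ('o \<Rightarrow> real \<Rightarrow> real) \<Rightarrow> ('o \<Rightarrow> real)
     \<Rightarrow> (nat \<Rightarrow> 'o \<Rightarrow> exc \<Rightarrow> nat) \<Rightarrow> bool" where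
  "is_brownian_fan a Q M X L N \<longleftrightarrow>
     is_BM M X 0 \<and>
     distributed M lborel L (exponential_density (1 / a)) \<and>
     indep_rv M (borel :: real measure) L path_M X \<and>
     (\<forall>\<omega>\<in>space M. N 0 \<omega> = (\<lambda>w. if w = kill (- L \<omega>) (X \<omega>) then 1 else 0)) \<and>
     (\<forall>k A. A \<in> sets exc_M \<longrightarrow> (\<lambda>\<omega>. cnt (N k \<omega>) A) \<in> borel_measurable M) \<and>
     (\<forall>n f E. 1 \<le> n \<longrightarrow> f \<in> borel_measurable exc_M \<longrightarrow> (\<forall>w. 0 \<le> f w) \<longrightarrow>
        E \<in> gen_sigma M N n \<longrightarrow>
        (\<integral>\<^sup>+ \<omega>. indicator E \<omega> * enexp_neg (cint (N n \<omega>) (\<lambda>w. ennreal (f w))) \<partial>M)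
        = (\<integral>\<^sup>+ \<omega>. indicator E \<omega> *
              enexp_neg (cint (N (n - 1) \<omega>)
                 (\<lambda>w. kern_int a Q w (\<lambda>v. ennreal (1 - exp (- f v))))) \<partial>M))"

definition alive :: "(nat \<Rightarrow> 'o \<Rightarrow> exc \<Rightarrow> nat) \<Rightarrow> 'o \<Rightarrow> real \<Rightarrow> ennreal" where
  "alive N \<omega> t = (\<Sum>n. cnt (N n \<omega>) {w. ereal (exc_start w) < ereal t \<and> ereal t < exc_end w})"

end

theory Submission
  imports Defs
begin

text \<open>
  Only the starting and end times of the particles matter. The lifetime under Ito's measure has a
  tail of order 1 / sqrt r, so the mean number of particles alive at time t solves a renewal
  equation with an integrable singularity. Hence the nonlinear inequality
  \<lambda> 1[alive] + Q (exp V - 1) \<le> V, with Q the branching kernel, has an explicit solution V \<le> 1 as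
  soon as \<lambda> is small depending on t, and formally E exp (\<lambda> N) \<le> E exp (V w) \<le> exp 1, where N is
  the number of particles alive at time t and w the initial particle.

  The Laplace functional defining the fan only involves negative exponents. For 0 < z < 1 it
  shows, going back one generation at a time, that the number Z of living particles in the first
  n generations satisfies E (z ^ Z) = E (pgf n z w) with a recursively defined pgf. Since pgf n is
  a power series in z with nonnegative coefficients, uniqueness of power series identifies the law
  of Z, and the identity extends to z = exp \<lambda> > 1, where V bounds pgf n uniformly in n.
\<close>


section \<open>Power series with nonnegative coefficients\<close>

text \<open>Ito's measure charges short excursions with infinite mass, so \<open>kern\<close> of the
  constant 1 is infinite and each cancellation of exponentials needs a finiteness proof. All of
  these come from comparison with one function, \<open>dominating\<close>, which vanishes for
  particles born at or after time t. Multiplied by \<lambda>, the same function is V: it satisfies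
  the renewal inequality for twice the branching rate, and the spare factor 2 pays for the
  nonlinearity through exp x - 1 \<le> 2 x on [0,1]. The requirement V \<le> 1 dictates \<lambda>,
  the reciprocal of an upper bound of \<open>dominating\<close> over starting times at least 0.

  The second obstacle is measurability. Only the counts of measurable sets of excursions are known
  to be random variables; a configuration could charge points outside \<open>Exc\<close>, and the
  initial particle is not known to be a measurable map. Hence integrals against configurations are
  cut down to \<open>Exc\<close>, and identities hold almost everywhere.\<close>

lemma enexp_pos_eq_suminf: "enexp_pos 1 x = (\<Sum>i. x ^ i * ennreal (1 / fact i))"
proof (cases x)
  case (real r)
  have "(\<lambda>i. r ^ i * (1 / fact i)) sums exp r"
    using exp_converges[of r] by (simp add: scaleR_conv_of_real field_simps)
  then have "(\<Sum>i. ennreal (r ^ i * (1 / fact i))) = ennreal (exp r)"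
    using real by (intro suminf_ennreal_eq) auto
  moreover have "ennreal (r ^ i * (1 / fact i)) = x ^ i * ennreal (1 / fact i)" for i
    using real by (subst ennreal_mult) (simp_all add: ennreal_power)
  ultimately show ?thesis
    using real by (simp add: enexp_pos_def)
next
  case top
  have "(\<infinity>::ennreal) = x ^ 1 * ennreal (1 / fact 1)"
    using top by simp
  also have "\<dots> \<le> (\<Sum>i. x ^ i * ennreal (1 / fact i))"
    using sum_le_suminf[of "\<lambda>i. x ^ i * ennreal (1 / fact i)" "{1}"] by simp
  finally show ?thesis
    using top by (simp add: enexp_pos_def top_unique)
qed

lemma suminf_swap_ennreal:
  fixes f :: "nat \<Rightarrow> nat \<Rightarrow> ennreal"
  shows "(\<Sum>i. \<Sum>j. f i j) = (\<Sum>j. \<Sum>i. f i j)"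
  using nn_integral_suminf[of f "count_space UNIV"] by (simp add: nn_integral_count_space_nat)

text \<open>Cauchy product by Tonelli for counting measure, so no convergence is assumed. Row i of
  the double sum is shifted by i places and padded with zeros below n = i.\<close>

lemma suminf_mult_suminf_ennreal:
  fixes f g :: "nat \<Rightarrow> ennreal"
  shows "(\<Sum>i. f i) * (\<Sum>j. g j) = (\<Sum>n. \<Sum>i\<le>n. f i * g (n - i))"
proof -
  have "(\<Sum>i. f i) * (\<Sum>j. g j) = (\<Sum>i. \<Sum>j. f i * g j)"
    by simp
  also have "\<dots> = (\<Sum>i. \<Sum>n. if i \<le> n then f i * g (n - i) else 0)"
  proof (rule suminf_cong)
    fix i
    have "(\<Sum>n. if i \<le> n then f i * g (n - i) else 0)
        = (\<Sum>n. if i \<le> n + i then f i * g (n + i - i) else 0)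
          + (\<Sum>n<i. if i \<le> n then f i * g (n - i) else 0)"
      by (rule suminf_offset) auto
    then show "(\<Sum>j. f i * g j) = (\<Sum>n. if i \<le> n then f i * g (n - i) else 0)"
      by simp
  qed
  also have "\<dots> = (\<Sum>n. \<Sum>i. if i \<le> n then f i * g (n - i) else 0)"
    by (rule suminf_swap_ennreal)
  also have "\<dots> = (\<Sum>n. \<Sum>i\<le>n. f i * g (n - i))"
  proof (intro suminf_cong)
    fix n
    have "(\<Sum>i. if i \<le> n then f i * g (n - i) else 0) = (\<Sum>i\<in>{..n}. if i \<le> n then f i * g (n - i) else 0)"
      by (rule suminf_finite) auto
    then show "(\<Sum>i. if i \<le> n then f i * g (n - i) else 0) = (\<Sum>i\<le>n. f i * g (n - i))"
      by simp
  qed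
  finally show ?thesis .
qed

text \<open>The coefficients are functions of w and do not depend on z, and the expansion holds for
  all z, including infinity. This is what lets an identity known for z < 1 be carried over to z >
  1.\<close>

definition pos_power_series :: "'a measure \<Rightarrow> (ennreal \<Rightarrow> 'a \<Rightarrow> ennreal) \<Rightarrow> bool" where
  "pos_power_series S F \<longleftrightarrow>
     (\<exists>c. (\<forall>k::nat. c k \<in> borel_measurable S) \<and> (\<forall>z w. F z w = (\<Sum>k. c k w * z ^ k)))"

lemma pos_power_series_const:
  "f \<in> borel_measurable S \<Longrightarrow> pos_power_series S (\<lambda>z. f)"
  unfolding pos_power_series_def
  using suminf_offset[of "\<lambda>k. (if k = 0 then f w else 0) * z ^ k" 1 for w and z :: ennreal]
  by (intro exI[of _ "\<lambda>k w. if k = 0 then f w else 0"]) auto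

lemma pos_power_series_mult:
  assumes "pos_power_series S F" "pos_power_series S H"
  shows "pos_power_series S (\<lambda>z w. F z w * H z w)"
proof -
  obtain c where c: "\<And>k. c k \<in> borel_measurable S" "\<And>z w. F z w = (\<Sum>k. c k w * z ^ k)"
    using assms(1) by (auto simp: pos_power_series_def)
  obtain d where d: "\<And>k. d k \<in> borel_measurable S" "\<And>z w. H z w = (\<Sum>k. d k w * z ^ k)"
    using assms(2) by (auto simp: pos_power_series_def)
  have "F z w * H z w = (\<Sum>k. (\<Sum>i\<le>k. c i w * d (k - i) w) * z ^ k)" for z w
  proof -
    have "F z w * H z w = (\<Sum>k. \<Sum>i\<le>k. (c i w * z ^ i) * (d (k - i) w * z ^ (k - i)))"
      by (simp only: c d suminf_mult_suminf_ennreal)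
    also have "\<dots> = (\<Sum>k. \<Sum>i\<le>k. c i w * d (k - i) w * z ^ k)"
    proof (intro suminf_cong sum.cong refl)
      fix k i :: nat assume "i \<in> {..k}"
      then have "z ^ k = z ^ i * z ^ (k - i)"
        by (simp flip: power_add)
      then show "(c i w * z ^ i) * (d (k - i) w * z ^ (k - i)) = c i w * d (k - i) w * z ^ k"
        by (simp add: ac_simps)
    qed
    finally show ?thesis
      by (simp add: sum_distrib_right)
  qed
  moreover have "(\<lambda>w. \<Sum>i\<le>k. c i w * d (k - i) w) \<in> borel_measurable S" for k
    using c(1) d(1) by measurable
  ultimately show ?thesis
    unfolding pos_power_series_def by (intro exI[of _ "\<lambda>k w. \<Sum>i\<le>k. c i w * d (k - i) w"]) auto
qed

lemma pos_power_series_suminf: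
  assumes "\<And>i::nat. pos_power_series S (F i)"
  shows "pos_power_series S (\<lambda>z w. \<Sum>i. F i z w)"
proof -
  have "\<forall>i. \<exists>c. (\<forall>k. c k \<in> borel_measurable S) \<and> (\<forall>z w. F i z w = (\<Sum>k. c k w * z ^ k))"
    using assms by (auto simp: pos_power_series_def)
  then obtain c where c: "\<And>i k. c i k \<in> borel_measurable S" "\<And>i z w. F i z w = (\<Sum>k. c i k w * z ^ k)"
    by metis
  have "(\<Sum>i. F i z w) = (\<Sum>k. (\<Sum>i. c i k w) * z ^ k)" for z w
    by (simp add: c(2) suminf_swap_ennreal[of "\<lambda>i k. c i k w * z ^ k"])
  moreover have "(\<lambda>w. \<Sum>i. c i k w) \<in> borel_measurable S" for k
    using c(1) by measurable
  ultimately show ?thesis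
    unfolding pos_power_series_def by (intro exI[of _ "\<lambda>k w. \<Sum>i. c i k w"]) auto
qed

lemma pos_power_series_power:
  "pos_power_series S F \<Longrightarrow> pos_power_series S (\<lambda>z w. F z w ^ i)"
  by (induction i) (simp_all add: pos_power_series_const pos_power_series_mult)

lemma pos_power_series_exp:
  "pos_power_series S F \<Longrightarrow> pos_power_series S (\<lambda>z w. enexp_pos 1 (F z w))"
  unfolding enexp_pos_eq_suminf
  by (intro pos_power_series_suminf pos_power_series_mult pos_power_series_power pos_power_series_const)
     auto

text \<open>Differences usually spoil nonnegativity of coefficients. The value at 0 is exactly the
  constant coefficient, however, so subtracting it merely erases that coefficient; finiteness makes
  the cancellation legitimate.\<close>

lemma pos_power_series_minus_at_0:
  assumes "pos_power_series S F" "\<And>w. F 0 w < \<infinity>"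
  shows "pos_power_series S (\<lambda>z w. F z w - F 0 w)"
proof -
  obtain c where c: "\<And>k. c k \<in> borel_measurable S" "\<And>z w. F z w = (\<Sum>k. c k w * z ^ k)"
    using assms(1) by (auto simp: pos_power_series_def)
  have F: "F z w = (\<Sum>k. c (Suc k) w * z ^ Suc k) + c 0 w" for z w
    using suminf_offset[of "\<lambda>k. c k w * z ^ k" 1] c(2) by simp
  have F0: "F 0 w = c 0 w" for w
    using F[of 0 w] by simp
  have "F z w - F 0 w = (\<Sum>k. (if k = 0 then 0 else c k w) * z ^ k)" for z w
  proof -
    have "(\<Sum>k. (if k = 0 then 0 else c k w) * z ^ k) = (\<Sum>k. c (Suc k) w * z ^ Suc k)"
      using suminf_offset[of "\<lambda>k. (if k = 0 then 0 else c k w) * z ^ k" 1] by simp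
    then show ?thesis
      using assms(2)[of w] unfolding F0 F by (simp add: less_top)
  qed
  then show ?thesis
    unfolding pos_power_series_def using c(1)
    by (intro exI[of _ "\<lambda>k w. if k = 0 then 0 else c k w"]) auto
qed

lemma pos_power_series_mono:
  assumes "pos_power_series S F" "z \<le> z'"
  shows "F z w \<le> F z' w"
  using assms unfolding pos_power_series_def
  by (auto intro!: suminf_le mult_left_mono power_mono)

lemma pos_power_series_measurable:
  assumes "pos_power_series S F"
  shows "F z \<in> borel_measurable S"
proof -
  obtain c where c: "\<And>k. c k \<in> borel_measurable S" "\<And>z w. F z w = (\<Sum>k. c k w * z ^ k)"
    using assms(1) by (auto simp: pos_power_series_def)
  have "F z = (\<lambda>w. \<Sum>k. c k w * z ^ k)"
    using c by auto
  also have "\<dots> \<in> borel_measurable S"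
    using c(1) by measurable
  finally show ?thesis .
qed

section \<open>A supersolution of the renewal equation\<close>

lemma nn_integral_inverse_sqrt:
  fixes r :: real
  assumes "0 \<le> r"
  shows "(\<integral>\<^sup>+x. ennreal (1 / sqrt x) * indicator {0..r} x \<partial>lborel) = ennreal (2 * sqrt r)"
proof -
  have "((\<lambda>x. x powr (-1/2)) has_integral (r powr (-1/2+1) / (-1/2+1))) {0..r}"
    using assms by (intro has_integral_powr_from_0) auto
  then have "((\<lambda>x. x powr (-1/2)) has_integral 2 * sqrt r) {0..r}"
    using assms by (simp add: powr_half_sqrt mult.commute)
  moreover have "x powr (-1/2) = 1 / sqrt x" if "x \<in> {0..r}" for x
    using that powr_minus[of x "1/2"] by (simp add: powr_half_sqrt inverse_eq_divide)
  ultimately have "((\<lambda>x. 1 / sqrt x) has_integral 2 * sqrt r) {0..r}"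
    by (rule has_integral_eq[rotated])
  then show ?thesis
    by (intro nn_integral_has_integral_lebesgue') auto
qed

lemma nn_integral_inverse_sqrt_reflect:
  fixes r :: real
  assumes "0 \<le> r"
  shows "(\<integral>\<^sup>+x. ennreal (1 / sqrt (r - x)) * indicator {0..r} x \<partial>lborel) = ennreal (2 * sqrt r)"
proof -
  have "(\<integral>\<^sup>+x. ennreal (1 / sqrt (r - x)) * indicator {0..r} x \<partial>lborel)
      = (\<integral>\<^sup>+x. ennreal (1 / sqrt (r - (r + (-1) * x))) * indicator {0..r} (r + (-1) * x) \<partial>lborel)"
    by (subst nn_integral_real_affine[where c = "-1" and t = r]) auto
  also have "\<dots> = (\<integral>\<^sup>+x. ennreal (1 / sqrt x) * indicator {0..r} x \<partial>lborel)"
    by (intro nn_integral_cong) (auto simp: indicator_def)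
  finally show ?thesis
    using nn_integral_inverse_sqrt[OF assms] by simp
qed

lemma nn_integral_exp_decay:
  fixes \<kappa> :: real
  assumes "0 < \<kappa>"
  shows "(\<integral>\<^sup>+x. ennreal (exp (- \<kappa> * x)) * indicator {0..} x \<partial>lborel) = ennreal (1 / \<kappa>)"
proof -
  have "filterlim (\<lambda>x. - \<kappa> * x) at_bot at_top"
    using assms by (intro filterlim_tendsto_neg_mult_at_bot[OF tendsto_const _ filterlim_ident]) auto
  then have "((\<lambda>x. - exp (- \<kappa> * x) / \<kappa>) \<longlongrightarrow> - 0 / \<kappa>) at_top"
    using assms by (intro tendsto_divide tendsto_minus tendsto_const filterlim_compose[OF exp_at_bot]) auto
  then have "(\<integral>\<^sup>+x. ennreal (exp (- \<kappa> * x)) * indicator {0..} x \<partial>lborel)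
      = ennreal (- 0 / \<kappa> - (- exp (- \<kappa> * 0) / \<kappa>))"
    using assms by (intro nn_integral_FTC_atLeast) (auto intro!: derivative_eq_intros)
  then show ?thesis
    by simp
qed

text \<open>The first term reproduces the inhomogeneity; its convolution with the inverse square root is
  bounded, and the exponential rate is large enough that half of the second term absorbs this
  bound while the other half absorbs the convolution of the second term itself.\<close>
definition renewal_bound :: "real \<Rightarrow> real \<Rightarrow> real" where
  "renewal_bound \<alpha> r = \<alpha> / sqrt r + 8 * \<alpha>\<^sup>2 * exp (36 * \<alpha>\<^sup>2 * r)"

lemma renewal_bound_measurable [measurable]: "renewal_bound \<alpha> \<in> borel_measurable borel"
  unfolding renewal_bound_def by measurable

lemma renewal_bound_nonneg: "0 < \<alpha> \<Longrightarrow> 0 \<le> r \<Longrightarrow> 0 \<le> renewal_bound \<alpha> r"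
  by (simp add: renewal_bound_def)

text \<open>For the singular part, sqrt r \<le> sqrt y + sqrt (r - y) splits the product of two
  inverse roots into a sum of single ones. For the exponential part the integral is cut at y = 1 /
  (36 \<alpha>^2): below it the decaying factor is replaced by 1, above it 1 / sqrt y is at most 6
  \<alpha>.\<close>

lemma renewal_bound_convolution_pointwise:
  fixes \<alpha> r y :: real
  assumes "0 < \<alpha>" "0 < y" "y < r"
  shows "renewal_bound \<alpha> (r - y) / sqrt y \<le>
    \<alpha> / sqrt r * (1 / sqrt y) + \<alpha> / sqrt r * (1 / sqrt (r - y)) +
    8 * \<alpha>\<^sup>2 * exp (36 * \<alpha>\<^sup>2 * r) * ((if y \<le> 1 / (36 * \<alpha>\<^sup>2) then 1 / sqrt y else 0) + 6 * \<alpha> * exp (- (36 * \<alpha>\<^sup>2) * y))"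
proof -
  define p q where "p = sqrt y" and "q = sqrt (r - y)"
  have pq: "0 < p" "0 < q" "p\<^sup>2 + q\<^sup>2 = r"
    using assms by (auto simp: p_def q_def)
  have "sqrt r \<le> p + q"
    using pq by (intro real_le_lsqrt) (auto simp: power2_eq_square algebra_simps)
  then have "1 / (p * q) \<le> (p + q) / (sqrt r * (p * q))"
    using pq assms by (simp add: field_simps)
  also have "\<dots> = 1 / sqrt r * (1 / p) + 1 / sqrt r * (1 / q)"
    using pq assms by (simp add: field_simps)
  finally have "\<alpha> * (1 / (p * q)) \<le> \<alpha> * (1 / sqrt r * (1 / p) + 1 / sqrt r * (1 / q))"
    using assms by (intro mult_left_mono) auto
  then have 1: "\<alpha> / q / p \<le> \<alpha> / sqrt r * (1 / p) + \<alpha> / sqrt r * (1 / q)"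
    by (simp add: field_simps)
  have "exp (- (36 * \<alpha>\<^sup>2) * y) / p \<le> (if y \<le> 1 / (36 * \<alpha>\<^sup>2) then 1 / p else 0) + 6 * \<alpha> * exp (- (36 * \<alpha>\<^sup>2) * y)"
  proof (cases "y \<le> 1 / (36 * \<alpha>\<^sup>2)")
    case True
    have "exp (- (36 * \<alpha>\<^sup>2) * y) / p \<le> 1 / p"
      using assms pq by (intro divide_right_mono) auto
    also have "\<dots> \<le> 1 / p + 6 * \<alpha> * exp (- (36 * \<alpha>\<^sup>2) * y)"
      using assms by auto
    finally show ?thesis
      using True by simp
  next
    case False
    then have "1 / (6 * \<alpha>) \<le> p"
      unfolding p_def using assms by (intro real_le_rsqrt) (auto simp: power_divide power_mult_distrib)
    then have "1 / p \<le> 6 * \<alpha>"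
      using assms pq by (simp add: field_simps)
    then have "(1 / p) * exp (- (36 * \<alpha>\<^sup>2) * y) \<le> 6 * \<alpha> * exp (- (36 * \<alpha>\<^sup>2) * y)"
      by (intro mult_right_mono) auto
    then show ?thesis
      using False by simp
  qed
  then have "8 * \<alpha>\<^sup>2 * exp (36 * \<alpha>\<^sup>2 * r) * (exp (- (36 * \<alpha>\<^sup>2) * y) / p)
    \<le> 8 * \<alpha>\<^sup>2 * exp (36 * \<alpha>\<^sup>2 * r) * ((if y \<le> 1 / (36 * \<alpha>\<^sup>2) then 1 / p else 0) + 6 * \<alpha> * exp (- (36 * \<alpha>\<^sup>2) * y))"
    by (intro mult_left_mono) auto
  also have "8 * \<alpha>\<^sup>2 * exp (36 * \<alpha>\<^sup>2 * r) * (exp (- (36 * \<alpha>\<^sup>2) * y) / p) = 8 * \<alpha>\<^sup>2 * exp (36 * \<alpha>\<^sup>2 * (r - y)) / p"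
    by (simp add: right_diff_distrib exp_diff exp_minus field_simps)
  finally show ?thesis
    using 1 unfolding renewal_bound_def p_def q_def by (simp add: add_divide_distrib)
qed

text \<open>Write \<kappa> for the rate and \<gamma> for the second term of
  \<open>renewal_bound\<close>. The pointwise bound integrates to 4 \<alpha> from the singular part
  and to 3 \<gamma> / sqrt \<kappa> from the exponential part. The rate 36 \<alpha>^2 is chosen so
  that 3 / sqrt \<kappa> = 1 / (2 \<alpha>): after multiplication by \<alpha> the exponential part
  costs exactly \<gamma> / 2.\<close>

lemma renewal_bound_supersolution:
  fixes \<alpha> r :: real
  assumes "0 < \<alpha>" "0 < r"
  shows "ennreal (1 / sqrt r) + (\<integral>\<^sup>+y. indicator {0<..<r} y * ennreal (renewal_bound \<alpha> (r - y) / sqrt y) \<partial>lborel)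
    \<le> ennreal (renewal_bound \<alpha> r / \<alpha>)"
proof -
  define \<beta> where "\<beta> = \<alpha> / sqrt r"
  define \<gamma> where "\<gamma> = 8 * \<alpha>\<^sup>2 * exp (36 * \<alpha>\<^sup>2 * r)"
  define \<kappa> where "\<kappa> = 36 * \<alpha>\<^sup>2"
  have pos: "0 < \<beta>" "0 < \<gamma>" "0 < \<kappa>"
    using assms by (auto simp: \<beta>_def \<gamma>_def \<kappa>_def)
  have sq: "sqrt \<kappa> = 6 * \<alpha>"
    unfolding \<kappa>_def using assms by (intro real_sqrt_unique) (auto simp: power2_eq_square)
  have "(\<integral>\<^sup>+y. indicator {0<..<r} y * ennreal (renewal_bound \<alpha> (r - y) / sqrt y) \<partial>lborel)
     \<le> (\<integral>\<^sup>+y. ennreal \<beta> * (ennreal (1 / sqrt y) * indicator {0..r} y) +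
             (ennreal \<beta> * (ennreal (1 / sqrt (r - y)) * indicator {0..r} y) +
             ennreal \<gamma> * ((ennreal (1 / sqrt y) * indicator {0..1 / \<kappa>} y) +
                ennreal (6 * \<alpha>) * (ennreal (exp (- \<kappa> * y)) * indicator {0..} y))) \<partial>lborel)"
  proof (intro nn_integral_mono)
    fix y :: real
    show "indicator {0<..<r} y * ennreal (renewal_bound \<alpha> (r - y) / sqrt y) \<le>
        ennreal \<beta> * (ennreal (1 / sqrt y) * indicator {0..r} y) +
             (ennreal \<beta> * (ennreal (1 / sqrt (r - y)) * indicator {0..r} y) +
             ennreal \<gamma> * ((ennreal (1 / sqrt y) * indicator {0..1 / \<kappa>} y) +
                ennreal (6 * \<alpha>) * (ennreal (exp (- \<kappa> * y)) * indicator {0..} y)))"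
    proof (cases "y \<in> {0<..<r}")
      case True
      have "ennreal (renewal_bound \<alpha> (r - y) / sqrt y) \<le> ennreal (\<beta> * (1 / sqrt y) + (\<beta> * (1 / sqrt (r - y)) +
         \<gamma> * ((if y \<le> 1 / \<kappa> then 1 / sqrt y else 0) + 6 * \<alpha> * exp (- \<kappa> * y))))"
        using renewal_bound_convolution_pointwise[of \<alpha> y r] True assms
        by (intro ennreal_leI) (simp add: \<beta>_def \<gamma>_def \<kappa>_def)
      also have "\<dots> = ennreal \<beta> * ennreal (1 / sqrt y) + (ennreal \<beta> * ennreal (1 / sqrt (r - y)) +
         ennreal \<gamma> * (ennreal (if y \<le> 1 / \<kappa> then 1 / sqrt y else 0) + ennreal (6 * \<alpha>) * ennreal (exp (- \<kappa> * y))))"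
        using True pos assms by (simp add: ennreal_plus ennreal_mult del: ennreal_plus[symmetric] times_divide_eq_right)
      finally show ?thesis
        using True by (auto simp: indicator_def split: if_splits)
    qed simp
  qed
  also have "\<dots> = ennreal \<beta> * ennreal (2 * sqrt r) + (ennreal \<beta> * ennreal (2 * sqrt r) +
       ennreal \<gamma> * (ennreal (2 * sqrt (1 / \<kappa>)) + ennreal (6 * \<alpha>) * ennreal (1 / \<kappa>)))"
  proof -
    have *: "(\<integral>\<^sup>+y. ennreal \<beta> * f1 y + (ennreal \<beta> * f2 y + ennreal \<gamma> * (f3 y + ennreal (6 * \<alpha>) * f4 y)) \<partial>lborel) =
        ennreal \<beta> * integral\<^sup>N lborel f1 + (ennreal \<beta> * integral\<^sup>N lborel f2 +
          ennreal \<gamma> * (integral\<^sup>N lborel f3 + ennreal (6 * \<alpha>) * integral\<^sup>N lborel f4))"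
      if [measurable]: "f1 \<in> borel_measurable borel" "f2 \<in> borel_measurable borel"
        "f3 \<in> borel_measurable borel" "f4 \<in> borel_measurable borel" for f1 f2 f3 f4 :: "real \<Rightarrow> ennreal"
      by (simp add: nn_integral_add nn_integral_cmult)
    show ?thesis
      by (subst *; (measurable)?)
         (use assms pos in \<open>simp only: nn_integral_inverse_sqrt nn_integral_inverse_sqrt_reflect
            nn_integral_exp_decay less_imp_le zero_le_divide_1_iff\<close>)
  qed
  also have "\<dots> = ennreal (\<beta> * (2 * sqrt r) + (\<beta> * (2 * sqrt r) + \<gamma> * (2 * sqrt (1 / \<kappa>) + 6 * \<alpha> * (1 / \<kappa>))))"
  proof -
    have **: "ennreal b * ennreal u + (ennreal b * ennreal u + ennreal c * (ennreal v + ennreal d * ennreal w))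
      = ennreal (b * u + (b * u + c * (v + d * w)))" if "0 \<le> b" "0 \<le> u" "0 \<le> c" "0 \<le> v" "0 \<le> d" "0 \<le> w" for b u c v d w
      using that by (simp only: ennreal_plus ennreal_mult add_nonneg_nonneg mult_nonneg_nonneg)
    show ?thesis
      using pos assms by (intro **) auto
  qed
  also have "\<beta> * (2 * sqrt r) + (\<beta> * (2 * sqrt r) + \<gamma> * (2 * sqrt (1 / \<kappa>) + 6 * \<alpha> * (1 / \<kappa>))) = 4 * \<alpha> + \<gamma> / (2 * \<alpha>)"
  proof -
    have "\<beta> * (2 * sqrt r) = 2 * \<alpha>"
      using assms by (simp add: \<beta>_def)
    moreover have "2 * sqrt (1 / \<kappa>) + 6 * \<alpha> * (1 / \<kappa>) = 1 / (2 * \<alpha>)"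
      unfolding real_sqrt_divide sq using assms by (simp add: \<kappa>_def power2_eq_square divide_simps)
    ultimately show ?thesis
      by (simp only:) simp
  qed
  finally have "ennreal (1 / sqrt r) + (\<integral>\<^sup>+y. indicator {0<..<r} y * ennreal (renewal_bound \<alpha> (r - y) / sqrt y) \<partial>lborel)
     \<le> ennreal (1 / sqrt r) + ennreal (4 * \<alpha> + \<gamma> / (2 * \<alpha>))"
    by (intro add_left_mono)
  also have "\<dots> = ennreal (1 / sqrt r + (4 * \<alpha> + \<gamma> / (2 * \<alpha>)))"
    using assms pos by (subst ennreal_plus) auto
  also have "\<dots> \<le> ennreal (renewal_bound \<alpha> r / \<alpha>)"
  proof (intro ennreal_leI)
    \<comment> \<open>The factor 8 is twice the 4 of the singular part: since the exponential is at
      least 1, the remaining \<gamma> / 2 covers 4 \<alpha>^2.\<close>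
    have "1 \<le> exp (36 * \<alpha>\<^sup>2 * r)"
      using assms by simp
    then have "8 * \<alpha>\<^sup>2 * 1 \<le> \<gamma>"
      unfolding \<gamma>_def using assms by (intro mult_left_mono) auto
    then have "4 * \<alpha> \<le> \<gamma> / (2 * \<alpha>)"
      using assms by (simp add: field_simps power2_eq_square)
    then show "1 / sqrt r + (4 * \<alpha> + \<gamma> / (2 * \<alpha>)) \<le> renewal_bound \<alpha> r / \<alpha>"
      using assms unfolding renewal_bound_def \<gamma>_def[symmetric] by (simp add: add_divide_distrib)
  qed
  finally show ?thesis .
qed

lemma nn_integral_renewal_bound:
  fixes \<alpha> t :: real
  assumes "0 < \<alpha>" "0 \<le> t"
  shows "(\<integral>\<^sup>+x. ennreal (renewal_bound \<alpha> (t - x)) * indicator {0..t} x \<partial>lborel)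
    \<le> ennreal (2 * \<alpha> * sqrt t + 8 * \<alpha>\<^sup>2 * exp (36 * \<alpha>\<^sup>2 * t) * t)"
proof -
  have "(\<integral>\<^sup>+x. ennreal (renewal_bound \<alpha> (t - x)) * indicator {0..t} x \<partial>lborel)
     \<le> (\<integral>\<^sup>+x. ennreal \<alpha> * (ennreal (1 / sqrt (t - x)) * indicator {0..t} x) +
          ennreal (8 * \<alpha>\<^sup>2 * exp (36 * \<alpha>\<^sup>2 * t)) * indicator {0..t} x \<partial>lborel)"
  proof (intro nn_integral_mono)
    fix x :: real
    show "ennreal (renewal_bound \<alpha> (t - x)) * indicator {0..t} x \<le>
      ennreal \<alpha> * (ennreal (1 / sqrt (t - x)) * indicator {0..t} x) +
          ennreal (8 * \<alpha>\<^sup>2 * exp (36 * \<alpha>\<^sup>2 * t)) * indicator {0..t} x"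
    proof (cases "x \<in> {0..t}")
      case True
      have "ennreal (renewal_bound \<alpha> (t - x)) \<le> ennreal (\<alpha> * (1 / sqrt (t - x)) + 8 * \<alpha>\<^sup>2 * exp (36 * \<alpha>\<^sup>2 * t))"
        using True assms by (intro ennreal_leI) (auto simp: renewal_bound_def intro!: mult_left_mono)
      also have "\<dots> = ennreal \<alpha> * ennreal (1 / sqrt (t - x)) + ennreal (8 * \<alpha>\<^sup>2 * exp (36 * \<alpha>\<^sup>2 * t))"
        using True assms by (subst ennreal_plus; (subst ennreal_mult)?; simp)
      finally show ?thesis
        using True by simp
    qed simp
  qed
  also have "\<dots> = ennreal \<alpha> * ennreal (2 * sqrt t) + ennreal (8 * \<alpha>\<^sup>2 * exp (36 * \<alpha>\<^sup>2 * t)) * ennreal t"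
  proof -
    have *: "(\<integral>\<^sup>+x. p * f x + q * indicator {0..t} x \<partial>lborel) = p * integral\<^sup>N lborel f + q * ennreal t"
      if [measurable]: "f \<in> borel_measurable borel" for p q and f :: "real \<Rightarrow> ennreal"
      using assms(2) by (simp add: nn_integral_add nn_integral_cmult nn_integral_cmult_indicator)
    show ?thesis
      unfolding nn_integral_inverse_sqrt_reflect[OF assms(2), symmetric] by (rule *) measurable
  qed
  also have "\<dots> = ennreal (\<alpha> * (2 * sqrt t) + 8 * \<alpha>\<^sup>2 * exp (36 * \<alpha>\<^sup>2 * t) * t)"
    using assms by (subst ennreal_plus; (subst ennreal_mult)?; (subst ennreal_mult)?; simp)
  finally show ?thesis
    by (simp add: mult.left_commute mult.assoc)
qed

section \<open>Generating functions of the progeny alive at a fixed time\<close>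

lemma enexp_neg_0 [simp]: "enexp_neg 0 = 1"
  and enexp_pos_0 [simp]: "enexp_pos c 0 = 1"
  by (simp_all add: enexp_neg_def enexp_pos_def)

lemma enexp_neg_ennreal: "0 \<le> x \<Longrightarrow> enexp_neg (ennreal x) = ennreal (exp (- x))"
  by (simp add: enexp_neg_def)

lemma enexp_pos_ennreal: "0 \<le> x \<Longrightarrow> enexp_pos c (ennreal x) = ennreal (exp (c * x))"
  by (simp add: enexp_pos_def)

lemma enexp_neg_add: "enexp_neg (x + y) = enexp_neg x * enexp_neg y"
  by (cases x; cases y) (auto simp: enexp_neg_def enn2real_plus simp flip: ennreal_mult exp_add)

lemma enexp_pos_add: "enexp_pos c (x + y) = enexp_pos c x * enexp_pos c y"
  by (cases x; cases y)
     (auto simp: enexp_pos_def enn2real_plus exp_add ennreal_mult distrib_left ennreal_mult_top ennreal_top_mult)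

lemma enexp_neg_mult_pos: "x < \<infinity> \<Longrightarrow> enexp_neg x * enexp_pos 1 x = 1"
  by (cases x) (auto simp: enexp_neg_def enexp_pos_def simp flip: ennreal_mult exp_add)

lemma enexp_neg_le_1: "enexp_neg x \<le> 1"
  by (auto simp: enexp_neg_def)

lemma enexp_neg_pos: "x < \<infinity> \<Longrightarrow> 0 < enexp_neg x"
  by (auto simp: enexp_neg_def)

lemma one_minus_enexp_neg_le: "1 - enexp_neg x \<le> x"
proof (cases x)
  case (real r)
  then show ?thesis
    using exp_ge_add_one_self[of "-r"]
    by (auto simp: enexp_neg_def ennreal_minus simp flip: ennreal_1 intro!: ennreal_leI)
qed simp

lemma enexp_pos_mono: "0 \<le> c \<Longrightarrow> x \<le> y \<Longrightarrow> enexp_pos c x \<le> enexp_pos c y"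
  by (auto simp: enexp_pos_def top_unique intro!: ennreal_leI mult_left_mono enn2real_mono simp: less_top)

lemma enexp_neg_measurable [measurable]: "enexp_neg \<in> borel_measurable borel"
  unfolding enexp_neg_def by measurable

lemma enexp_pos_measurable [measurable]: "enexp_pos c \<in> borel_measurable borel"
  unfolding enexp_pos_def by measurable

text \<open>\<open>\<zeta>\<close> stands for the law of the lifetime under the excursion measure,
  of which only the tail is controlled; its mass near 0 may be infinite. The observation time t is
  fixed throughout.\<close>

locale fan_kernel =
  fixes a D t :: real and \<zeta> :: "real measure"
  assumes a_pos: "0 < a" and D_pos: "0 < D"
    and sets_zeta [measurable_cong]: "sets \<zeta> = sets borel"
    and zeta_nonpos: "emeasure \<zeta> {..0} = 0"
    and zeta_tail: "0 < r \<Longrightarrow> emeasure \<zeta> {r<..} \<le> ennreal (D / sqrt r)"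
begin

text \<open>The nonpositive half-line and the tails beyond 1 / (n + 1) cover the line by sets of
  finite mass. Tonelli's theorem and the measurability of \<open>kern\<close> rely on this.\<close>

sublocale zeta: sigma_finite_measure \<zeta>
proof
  let ?A = "insert {..0} (range (\<lambda>n. {1 / real (Suc n)<..}))"
  have "x \<in> \<Union> ?A" for x
    using reals_Archimedean[of x] by (force simp: inverse_eq_divide not_le)
  then have "\<Union> ?A = space \<zeta>"
    using sets_eq_imp_space_eq[OF sets_zeta] by auto
  moreover have "emeasure \<zeta> {1 / real (Suc n)<..} \<noteq> \<infinity>" for n
    using zeta_tail[of "1 / real (Suc n)"] by (auto simp: top_unique)
  ultimately show "\<exists>A. countable A \<and> A \<subseteq> sets \<zeta> \<and> \<Union> A = space \<zeta> \<and> (\<forall>a\<in>A. emeasure \<zeta> a \<noteq> \<infinity>)"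
    using zeta_nonpos by (intro exI[of _ ?A] conjI) (auto simp: sets_zeta simp del: Union_insert)
qed

text \<open>The branching kernel seen through start and end times only: a child born at \<tau> with
  lifetime \<sigma> becomes the pair (\<tau>, \<tau> + \<sigma>), and positions in space
  disappear.\<close>

definition kern :: "(real \<times> ereal \<Rightarrow> ennreal) \<Rightarrow> real \<times> ereal \<Rightarrow> ennreal" where
  "kern g w = ennreal (a / 2) *
     (\<integral>\<^sup>+ \<tau>. indicator {\<tau>. fst w < \<tau> \<and> ereal \<tau> < snd w} \<tau> *
        (\<integral>\<^sup>+ \<sigma>. g (\<tau>, ereal (\<tau> + \<sigma>)) \<partial>\<zeta>) \<partial>lborel)"

abbreviation "SE \<equiv> (borel :: real measure) \<Otimes>\<^sub>M (borel :: ereal measure)"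

lemma kern_measurable [measurable]:
  assumes [measurable]: "g \<in> borel_measurable SE"
  shows "kern g \<in> borel_measurable SE"
  unfolding kern_def by measurable

text \<open>Children are born strictly after the start of their parent, so bounds that hold only for
  starts at least 0 survive an induction over generations.\<close>

lemma kern_mono_above:
  assumes "\<And>v. fst w < fst v \<Longrightarrow> f v \<le> g v"
  shows "kern f w \<le> kern g w"
  unfolding kern_def
  by (rule mult_left_mono, rule nn_integral_mono) (auto split: split_indicator intro!: nn_integral_mono assms)

lemma kern_add:
  assumes [measurable]: "f \<in> borel_measurable SE" "g \<in> borel_measurable SE"
  shows "kern (\<lambda>v. f v + g v) w = kern f w + kern g w"
  unfolding kern_def by (simp add: nn_integral_add distrib_left)

lemma kern_cmult:
  assumes [measurable]: "f \<in> borel_measurable SE"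
  shows "kern (\<lambda>v. c * f v) w = c * kern f w"
  unfolding kern_def by (simp add: nn_integral_cmult mult.left_commute)

lemma kern_0 [simp]: "kern (\<lambda>v. 0) w = 0"
  by (simp add: kern_def)

lemma kern_suminf:
  assumes [measurable]: "\<And>k. c k \<in> borel_measurable SE"
  shows "kern (\<lambda>v. \<Sum>k. c k v) w = (\<Sum>k. kern (c k) w)"
proof -
  have "(\<integral>\<^sup>+ \<sigma>. (\<Sum>k. c k (\<tau>, ereal (\<tau> + \<sigma>))) \<partial>\<zeta>) = (\<Sum>k. \<integral>\<^sup>+ \<sigma>. c k (\<tau>, ereal (\<tau> + \<sigma>)) \<partial>\<zeta>)" for \<tau>
    by (rule nn_integral_suminf) measurable
  moreover have "(\<integral>\<^sup>+ \<tau>. (\<Sum>k. indicator {\<tau>. fst w < \<tau> \<and> ereal \<tau> < snd w} \<tau> * (\<integral>\<^sup>+ \<sigma>. c k (\<tau>, ereal (\<tau> + \<sigma>)) \<partial>\<zeta>)) \<partial>lborel)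
     = (\<Sum>k. \<integral>\<^sup>+ \<tau>. indicator {\<tau>. fst w < \<tau> \<and> ereal \<tau> < snd w} \<tau> * (\<integral>\<^sup>+ \<sigma>. c k (\<tau>, ereal (\<tau> + \<sigma>)) \<partial>\<zeta>) \<partial>lborel)"
    by (intro nn_integral_suminf borel_measurable_times_ennreal) simp_all
  ultimately show ?thesis
    unfolding kern_def by simp
qed

text \<open>By Tonelli the kernel acts on each coefficient separately, for all z at once.\<close>

lemma pos_power_series_kern:
  assumes "pos_power_series SE F"
  shows "pos_power_series SE (\<lambda>z. kern (F z))"
proof -
  obtain c where c [measurable]: "\<And>k. c k \<in> borel_measurable SE" and F: "\<And>z w. F z w = (\<Sum>k. c k w * z ^ k)"
    using assms by (auto simp: pos_power_series_def)
  have "kern (F z) w = (\<Sum>k. kern (c k) w * z ^ k)" for z w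
  proof -
    have "kern (F z) w = (\<Sum>k. kern (\<lambda>v. z ^ k * c k v) w)"
      by (subst kern_suminf[symmetric]) (simp_all add: F[abs_def] mult.commute)
    then show ?thesis
      by (simp add: kern_cmult mult.commute)
  qed
  then show ?thesis
    unfolding pos_power_series_def by (intro exI[of _ "\<lambda>k. kern (c k)"]) auto
qed

section \<open>The dominating function\<close>

definition is_alive :: "real \<times> ereal \<Rightarrow> bool" where
  "is_alive w \<longleftrightarrow> fst w < t \<and> ereal t < snd w"

lemma is_alive_measurable [measurable]: "Measurable.pred SE is_alive"
  unfolding is_alive_def by measurable

text \<open>Bounds the mean number of living members, at time t and for doubled branching rate, of
  the family of w including w itself. The renewal bound at t - x controls the contribution of
  children born at time x per unit of the parent's lifetime; births after t are cut off.\<close>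

definition dominating :: "real \<times> ereal \<Rightarrow> ennreal" where
  "dominating w = of_bool (is_alive w) +
     (\<integral>\<^sup>+ x. indicator {x. fst w < x \<and> ereal x < snd w} x * (ennreal (renewal_bound (a * D) (t - x)) * indicator {..<t} x) \<partial>lborel)"

lemma dominating_measurable [measurable]: "dominating \<in> borel_measurable SE"
  unfolding dominating_def by measurable

text \<open>Only births between s and t contribute, so the bound does not involve the end of w,
  which may be infinite. The choice s = 0 later fixes \<lambda>; a general s gives finiteness for
  every w.\<close>

lemma dominating_le:
  assumes "s \<le> fst w" "s \<le> t"
  shows "dominating w \<le> 1 + ennreal (2 * (a * D) * sqrt (t - s) + 8 * (a * D)\<^sup>2 * exp (36 * (a * D)\<^sup>2 * (t - s)) * (t - s))"
proof -
  have "(\<integral>\<^sup>+ x. indicator {x. fst w < x \<and> ereal x < snd w} x * (ennreal (renewal_bound (a * D) (t - x)) * indicator {..<t} x) \<partial>lborel)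
    \<le> (\<integral>\<^sup>+ x. ennreal (renewal_bound (a * D) (t - x)) * indicator {s..t} x \<partial>lborel)"
    using assms by (intro nn_integral_mono) (auto simp: indicator_def)
  also have "\<dots> = (\<integral>\<^sup>+ x. ennreal (renewal_bound (a * D) (t - (s + 1 * x))) * indicator {s..t} (s + 1 * x) \<partial>lborel)"
    by (subst nn_integral_real_affine[where c = 1 and t = s]) auto
  also have "\<dots> = (\<integral>\<^sup>+ x. ennreal (renewal_bound (a * D) ((t - s) - x)) * indicator {0..t - s} x \<partial>lborel)"
    by (intro nn_integral_cong) (auto simp: indicator_def algebra_simps)
  also have "\<dots> \<le> ennreal (2 * (a * D) * sqrt (t - s) + 8 * (a * D)\<^sup>2 * exp (36 * (a * D)\<^sup>2 * (t - s)) * (t - s))"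
    using a_pos D_pos assms by (intro nn_integral_renewal_bound) auto
  finally show ?thesis
    unfolding dominating_def by (intro add_mono) auto
qed

lemma dominating_finite: "dominating w < \<infinity>"
  by (rule le_less_trans[OF dominating_le[of "min (fst w) t"]]) auto

text \<open>A child born at \<tau> can reproduce at time x only if its lifetime exceeds x - \<tau>.
  After exchanging the integrals the lifetime therefore enters through its tail, which turns the
  expression into the convolution with 1 / sqrt estimated in
  \<open>renewal_bound_supersolution\<close>.\<close>

lemma nn_integral_dominating_child:
  "(\<integral>\<^sup>+ \<sigma>. dominating (\<tau>, ereal (\<tau> + \<sigma>)) \<partial>\<zeta>) \<le>
     ennreal (renewal_bound (a * D) (t - \<tau>) / a) * indicator {..<t} \<tau>"
proof (cases "\<tau> < t")
  case False
  then have "dominating (\<tau>, ereal (\<tau> + \<sigma>)) = 0" for \<sigma>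
    by (auto simp: dominating_def is_alive_def indicator_def intro!: nn_integral_zero' AE_I2)
  then show ?thesis
    by simp
next
  case True
  let ?h = "renewal_bound (a * D)"
  interpret pair_sigma_finite \<zeta> lborel ..
  have "(\<integral>\<^sup>+ \<sigma>. \<integral>\<^sup>+ x. indicator {x. \<tau> < x \<and> x < \<tau> + \<sigma>} x * (ennreal (?h (t - x)) * indicator {..<t} x) \<partial>lborel \<partial>\<zeta>)
    = (\<integral>\<^sup>+ x. \<integral>\<^sup>+ \<sigma>. indicator {x. \<tau> < x \<and> x < \<tau> + \<sigma>} x * (ennreal (?h (t - x)) * indicator {..<t} x) \<partial>\<zeta> \<partial>lborel)"
    by (rule Fubini'[symmetric]) measurable
  also have "\<dots> \<le> (\<integral>\<^sup>+ x. indicator {\<tau><..<t} x * (ennreal (?h (t - x)) * ennreal (D / sqrt (x - \<tau>))) \<partial>lborel)"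
  proof (intro nn_integral_mono)
    fix x :: real
    show "(\<integral>\<^sup>+ \<sigma>. indicator {x. \<tau> < x \<and> x < \<tau> + \<sigma>} x * (ennreal (?h (t - x)) * indicator {..<t} x) \<partial>\<zeta>)
       \<le> indicator {\<tau><..<t} x * (ennreal (?h (t - x)) * ennreal (D / sqrt (x - \<tau>)))"
    proof (cases "x \<in> {\<tau><..<t}")
      case True
      have "(\<integral>\<^sup>+ \<sigma>. indicator {x. \<tau> < x \<and> x < \<tau> + \<sigma>} x * (ennreal (?h (t - x)) * indicator {..<t} x) \<partial>\<zeta>)
         = (\<integral>\<^sup>+ \<sigma>. ennreal (?h (t - x)) * indicator {x - \<tau><..} \<sigma> \<partial>\<zeta>)"
        using True by (intro nn_integral_cong) (auto simp: indicator_def)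
      also have "\<dots> = ennreal (?h (t - x)) * emeasure \<zeta> {x - \<tau><..}"
        by (subst nn_integral_cmult_indicator) (auto simp: sets_zeta)
      also have "\<dots> \<le> ennreal (?h (t - x)) * ennreal (D / sqrt (x - \<tau>))"
        using True by (intro mult_left_mono zeta_tail) auto
      finally show ?thesis
        using True by simp
    next
      case False
      then have "(\<integral>\<^sup>+ \<sigma>. indicator {x. \<tau> < x \<and> x < \<tau> + \<sigma>} x * (ennreal (?h (t - x)) * indicator {..<t} x) \<partial>\<zeta>) = (\<integral>\<^sup>+ \<sigma>. 0 \<partial>\<zeta>)"
        by (intro nn_integral_cong) (auto simp: indicator_def)
      then show ?thesis
        by simp
    qed
  qed
  also have "\<dots> = (\<integral>\<^sup>+ y. indicator {\<tau><..<t} (\<tau> + 1 * y) * (ennreal (?h (t - (\<tau> + 1 * y))) * ennreal (D / sqrt ((\<tau> + 1 * y) - \<tau>))) \<partial>lborel)"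
    using nn_integral_real_affine[of "\<lambda>x. indicator {\<tau><..<t} x * (ennreal (?h (t - x)) * ennreal (D / sqrt (x - \<tau>)))" 1 \<tau>]
    by (simp only: abs_one ennreal_1 mult_1 one_neq_zero not_False_eq_True) measurable
  also have "\<dots> = (\<integral>\<^sup>+ y. ennreal D * (indicator {0<..<t - \<tau>} y * ennreal (?h ((t - \<tau>) - y) / sqrt y)) \<partial>lborel)"
  proof (intro nn_integral_cong)
    fix y :: real
    show "indicator {\<tau><..<t} (\<tau> + 1 * y) * (ennreal (?h (t - (\<tau> + 1 * y))) * ennreal (D / sqrt ((\<tau> + 1 * y) - \<tau>)))
      = ennreal D * (indicator {0<..<t - \<tau>} y * ennreal (?h ((t - \<tau>) - y) / sqrt y))"
    proof (cases "y \<in> {0<..<t - \<tau>}")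
      case True
      then have "0 \<le> ?h (t - \<tau> - y)"
        using a_pos D_pos by (intro renewal_bound_nonneg) auto
      then have "ennreal (?h (t - \<tau> - y)) * ennreal (D / sqrt y) = ennreal D * ennreal (?h (t - \<tau> - y) / sqrt y)"
        using True D_pos by (simp add: mult.commute flip: ennreal_mult)
      then show ?thesis
        using True by (simp add: diff_diff_eq)
    qed (auto simp: indicator_def)
  qed
  also have "\<dots> = ennreal D * (\<integral>\<^sup>+ y. indicator {0<..<t - \<tau>} y * ennreal (?h ((t - \<tau>) - y) / sqrt y) \<partial>lborel)"
    by (intro nn_integral_cmult) measurable
  finally have descendants: "(\<integral>\<^sup>+ \<sigma>. \<integral>\<^sup>+ x. indicator {x. \<tau> < x \<and> x < \<tau> + \<sigma>} x * (ennreal (?h (t - x)) * indicator {..<t} x) \<partial>lborel \<partial>\<zeta>)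
     \<le> ennreal D * (\<integral>\<^sup>+ y. indicator {0<..<t - \<tau>} y * ennreal (?h ((t - \<tau>) - y) / sqrt y) \<partial>lborel)" .
  have "(\<integral>\<^sup>+ \<sigma>. dominating (\<tau>, ereal (\<tau> + \<sigma>)) \<partial>\<zeta>) =
     (\<integral>\<^sup>+ \<sigma>. indicator {t - \<tau><..} \<sigma> + (\<integral>\<^sup>+ x. indicator {x. \<tau> < x \<and> x < \<tau> + \<sigma>} x * (ennreal (?h (t - x)) * indicator {..<t} x) \<partial>lborel) \<partial>\<zeta>)"
    using True by (intro nn_integral_cong) (auto simp: dominating_def is_alive_def of_bool_def indicator_def)
  also have "\<dots> = emeasure \<zeta> {t - \<tau><..} +
      (\<integral>\<^sup>+ \<sigma>. \<integral>\<^sup>+ x. indicator {x. \<tau> < x \<and> x < \<tau> + \<sigma>} x * (ennreal (?h (t - x)) * indicator {..<t} x) \<partial>lborel \<partial>\<zeta>)"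
    by (subst nn_integral_add) (auto simp: sets_zeta)
  also have "\<dots> \<le> emeasure \<zeta> {t - \<tau><..} +
     ennreal D * (\<integral>\<^sup>+ y. indicator {0<..<t - \<tau>} y * ennreal (?h ((t - \<tau>) - y) / sqrt y) \<partial>lborel)"
    by (intro add_left_mono descendants)
  also have "\<dots> \<le> ennreal D * ennreal (1 / sqrt (t - \<tau>)) +
     ennreal D * (\<integral>\<^sup>+ y. indicator {0<..<t - \<tau>} y * ennreal (?h ((t - \<tau>) - y) / sqrt y) \<partial>lborel)"
    using zeta_tail[of "t - \<tau>"] True D_pos by (intro add_right_mono) (simp flip: ennreal_mult)
  also have "\<dots> \<le> ennreal D * ennreal (?h (t - \<tau>) / (a * D))"
    unfolding distrib_left[symmetric] using True a_pos D_pos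
    by (intro mult_left_mono renewal_bound_supersolution) auto
  also have "\<dots> = ennreal (?h (t - \<tau>) / a)"
    using True a_pos D_pos renewal_bound_nonneg[of "a * D" "t - \<tau>"] by (simp flip: ennreal_mult)
  finally show ?thesis
    using True by simp
qed

text \<open>The factor 2 cancels the half in a / 2. It is the reserve that makes a linear inequality
  sufficient for the exponential recursion.\<close>

lemma dominating_supersolution: "of_bool (is_alive w) + 2 * kern dominating w \<le> dominating w"
proof -
  have "2 * kern dominating w = ennreal a * (\<integral>\<^sup>+ \<tau>. indicator {\<tau>. fst w < \<tau> \<and> ereal \<tau> < snd w} \<tau> *
        (\<integral>\<^sup>+ \<sigma>. dominating (\<tau>, ereal (\<tau> + \<sigma>)) \<partial>\<zeta>) \<partial>lborel)"
    using a_pos unfolding kern_def mult.assoc[symmetric]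
    by (simp flip: ennreal_mult ennreal_numeral)
  also have "\<dots> \<le> ennreal a * (\<integral>\<^sup>+ \<tau>. indicator {\<tau>. fst w < \<tau> \<and> ereal \<tau> < snd w} \<tau> *
        (ennreal (renewal_bound (a * D) (t - \<tau>) / a) * indicator {..<t} \<tau>) \<partial>lborel)"
    by (intro mult_left_mono nn_integral_mono nn_integral_dominating_child) auto
  also have "\<dots> = (\<integral>\<^sup>+ \<tau>. ennreal a * (indicator {\<tau>. fst w < \<tau> \<and> ereal \<tau> < snd w} \<tau> *
        (ennreal (renewal_bound (a * D) (t - \<tau>) / a) * indicator {..<t} \<tau>)) \<partial>lborel)"
    by (intro nn_integral_cmult[symmetric]) measurable
  also have "\<dots> = (\<integral>\<^sup>+ \<tau>. indicator {\<tau>. fst w < \<tau> \<and> ereal \<tau> < snd w} \<tau> *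
        (ennreal (renewal_bound (a * D) (t - \<tau>)) * indicator {..<t} \<tau>) \<partial>lborel)"
    using a_pos D_pos renewal_bound_nonneg[of "a * D"]
    by (intro nn_integral_cong) (auto simp: indicator_def simp flip: ennreal_mult)
  finally show ?thesis
    unfolding dominating_def by (intro add_left_mono)
qed

end

text \<open>Origin of the factor 2 in \<open>dominating_supersolution\<close>, and of the smallness
  condition on \<lambda>.\<close>

lemma exp_minus_one_le_double: "x \<le> 1 \<Longrightarrow> enexp_pos 1 x - 1 \<le> 2 * x"
proof -
  assume "x \<le> 1"
  then obtain r where r: "x = ennreal r" "0 \<le> r" "r \<le> 1"
    by (cases x) (auto simp flip: ennreal_1 simp: top_unique)
  have "exp r \<le> 1 + r + r\<^sup>2"
    using r by (intro exp_bound) auto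
  moreover have "r\<^sup>2 \<le> r"
    using r by (simp add: power2_eq_square mult_left_le)
  ultimately have "exp r - 1 \<le> 2 * r"
    by simp
  then show ?thesis
    using r by (simp add: enexp_pos_ennreal ennreal_minus ennreal_leI flip: ennreal_1 ennreal_mult ennreal_numeral)
qed

lemma ennreal_diff_split:
  fixes x y z :: ennreal
  assumes "x \<le> y" "y \<le> z"
  shows "z - x = (z - y) + (y - x)"
  using assms
  by (cases x; cases y; cases z) (auto simp: ennreal_minus top_unique simp flip: ennreal_plus)

lemma pos_power_series_if:
  assumes [measurable]: "Measurable.pred S P"
  shows "pos_power_series S (\<lambda>z w. if P w then z else 1)"
proof -
  have "(if P w then z else 1) = (\<Sum>k. (if k = of_bool (P w) then 1 else 0) * z ^ k)" for z :: ennreal and w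
    using suminf_finite[of "{of_bool (P w)}" "\<lambda>k. (if k = of_bool (P w) then 1 else 0) * z ^ k"] by auto
  moreover have "(\<lambda>w. if k = of_bool (P w) then 1 else 0) \<in> borel_measurable S" for k :: nat
    unfolding of_bool_def by measurable
  ultimately show ?thesis
    unfolding pos_power_series_def
    by (intro exI[of _ "\<lambda>k w. if k = of_bool (P w) then 1 else 0"]) auto
qed

section \<open>The recursive generating functions below and above 1\<close>

context fan_kernel
begin

text \<open>For z at most 1 the last two factors combine to the exponential of minus the kernel applied to
  1 - pgf n z; this form also makes sense for z above 1 and displays the dependence on z as a
  power series with nonnegative coefficients.\<close>
primrec pgf :: "nat \<Rightarrow> ennreal \<Rightarrow> real \<times> ereal \<Rightarrow> ennreal" where
  "pgf 0 z w = 1"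
| "pgf (Suc n) z w = (if is_alive w then z else 1) * enexp_neg (kern (\<lambda>v. 1 - pgf n 0 v) w) *
     enexp_pos 1 (kern (\<lambda>v. pgf n z v - pgf n 0 v) w)"

lemma pgf_at_0_le_1: "pgf n 0 w \<le> 1"
proof (induction n arbitrary: w)
  case (Suc n)
  have "pgf n 0 v - pgf n 0 v = 0" for v
    using Suc[of v] by (intro diff_eq_0_ennreal) (auto simp: less_top[symmetric] top_unique)
  then show ?case
    using enexp_neg_le_1 by simp
qed simp

lemma pos_power_series_pgf: "pos_power_series SE (pgf n)"
proof (induction n)
  case 0
  then show ?case
    using pos_power_series_const[of "\<lambda>w. 1" SE] by (simp add: fun_eq_iff[symmetric] pgf.simps(1)[abs_def])
next
  case (Suc n)
  have [measurable]: "pgf n 0 \<in> borel_measurable SE"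
    using Suc by (rule pos_power_series_measurable)
  have fin: "pgf n 0 w < \<infinity>" for w
    using pgf_at_0_le_1[of n w] by (auto simp: less_top[symmetric] top_unique)
  show ?case
    unfolding pgf.simps(2)[abs_def]
    by (intro pos_power_series_mult pos_power_series_if pos_power_series_const pos_power_series_exp
        pos_power_series_kern pos_power_series_minus_at_0 Suc fin) measurable
qed

lemma pgf_measurable [measurable]: "pgf n z \<in> borel_measurable SE"
  by (rule pos_power_series_measurable[OF pos_power_series_pgf])

lemma pgf_mono: "z \<le> z' \<Longrightarrow> pgf n z w \<le> pgf n z' w"
  by (rule pos_power_series_mono[OF pos_power_series_pgf])

text \<open>Boundedness of f would not suffice for a kernel of infinite mass; domination does,
  because the supersolution inequality returns the kernel of \<open>dominating\<close> below
  \<open>dominating\<close> itself.\<close>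

lemma kern_finite:
  assumes "\<And>v. f v \<le> dominating v"
  shows "kern f w < \<infinity>"
proof -
  have "kern f w \<le> kern dominating w"
    by (intro kern_mono_above assms)
  also have "\<dots> \<le> of_bool (is_alive w) + 2 * kern dominating w"
    by (metis add_increasing mult_2 add_increasing2 order_refl zero_le)
  also have "\<dots> \<le> dominating w"
    by (rule dominating_supersolution)
  finally show ?thesis
    using dominating_finite[of w] by (rule le_less_trans)
qed

text \<open>The three claims depend on each other: the recursion simplifies at n + 1 only if the
  kernel of the defect at z = 0 is finite, which follows from the defect bound at n, and the
  simplified recursion then yields the defect bound at n + 1.\<close>

lemma pgf_le_1_and_defect:
  assumes "z \<le> 1"
  shows "pgf n z w \<le> 1 \<and> 1 - pgf n z w \<le> dominating w \<and>
    pgf (Suc n) z w = (if is_alive w then z else 1) * enexp_neg (kern (\<lambda>v. 1 - pgf n z v) w)"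
proof -
  have step: "pgf (Suc n) z w = (if is_alive w then z else 1) * enexp_neg (kern (\<lambda>v. 1 - pgf n z v) w)"
    if IH: "\<And>z w. z \<le> 1 \<Longrightarrow> pgf n z w \<le> 1 \<and> 1 - pgf n z w \<le> dominating w" and "z \<le> 1" for n z w
  proof -
    let ?A = "kern (\<lambda>v. 1 - pgf n z v) w" and ?B = "kern (\<lambda>v. pgf n z v - pgf n 0 v) w"
    have "1 - pgf n 0 v = (1 - pgf n z v) + (pgf n z v - pgf n 0 v)" for v
      using IH[of z v] that(2) pgf_mono[of 0 z n v] by (intro ennreal_diff_split) auto
    then have AB: "kern (\<lambda>v. 1 - pgf n 0 v) w = ?A + ?B"
      by (simp add: kern_add)
    have "kern (\<lambda>v. 1 - pgf n 0 v) w < \<infinity>"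
      using IH[of 0] by (intro kern_finite) auto
    then have "?B < \<infinity>"
      unfolding AB by (auto simp: less_top)
    then show ?thesis
      by (simp add: AB enexp_neg_add enexp_neg_mult_pos mult.assoc)
  qed
  have main: "pgf n z w \<le> 1 \<and> 1 - pgf n z w \<le> dominating w" if "z \<le> 1" for z w
    using that
  proof (induction n arbitrary: z w)
    case (Suc n)
    let ?A = "kern (\<lambda>v. 1 - pgf n z v) w"
    have eq: "pgf (Suc n) z w = (if is_alive w then z else 1) * enexp_neg ?A"
      using Suc by (intro step) auto
    have "(if is_alive w then z else 1) * enexp_neg ?A \<le> 1 * 1"
      using Suc.prems by (intro mult_mono enexp_neg_le_1) auto
    \<comment> \<open>For a living particle the trivial bound 1 is enough; otherwise 1 - exp (-x)
      \<le> x reduces the defect to the kernel of the defects of the children.\<close>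
    moreover have "1 - (if is_alive w then z else 1) * enexp_neg ?A \<le> of_bool (is_alive w) + 2 * kern dominating w"
    proof (cases "is_alive w")
      case True
      have "1 - z * enexp_neg ?A \<le> 1"
        by simp
      also have "\<dots> \<le> 1 + 2 * kern dominating w"
        by (simp add: add_increasing2)
      finally show ?thesis
        using True by simp
    next
      case False
      have "1 - enexp_neg ?A \<le> ?A"
        by (rule one_minus_enexp_neg_le)
      also have "\<dots> \<le> kern dominating w"
        using Suc by (intro kern_mono_above) auto
      also have "\<dots> \<le> 2 * kern dominating w"
        by (simp add: mult_2 add_increasing)
      finally show ?thesis
        using False by simp
    qed
    ultimately show ?case
      using dominating_supersolution[of w] unfolding eq by (auto intro: order_trans)
  qed simp
  show ?thesis
    using main[OF assms] step[OF _ assms] main by blast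
qed

lemma pgf_le_1: "z \<le> 1 \<Longrightarrow> pgf n z w \<le> 1"
  and pgf_defect_le: "z \<le> 1 \<Longrightarrow> 1 - pgf n z w \<le> dominating w"
  and pgf_Suc_below_1:
    "z \<le> 1 \<Longrightarrow> pgf (Suc n) z w = (if is_alive w then z else 1) * enexp_neg (kern (\<lambda>v. 1 - pgf n z v) w)"
  using pgf_le_1_and_defect by auto

text \<open>No mass escapes to infinity: this value later shows that the population of finitely many
  generations is almost surely finite.\<close>

lemma pgf_at_1: "pgf n 1 w = 1"
proof (induction n arbitrary: w)
  case (Suc n)
  then show ?case
    by (subst pgf_Suc_below_1) auto
qed simp

text \<open>Allows logarithms to be taken: a finite kernel keeps the exponential factor away from
  0.\<close>

lemma pgf_pos: "0 < z \<Longrightarrow> z \<le> 1 \<Longrightarrow> 0 < pgf n z w"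
proof (cases n)
  case (Suc m)
  assume z: "0 < z" "z \<le> 1"
  have "kern (\<lambda>v. 1 - pgf m z v) w < \<infinity>"
    using z by (intro kern_finite pgf_defect_le)
  then show ?thesis
    using z enexp_neg_pos unfolding Suc by (subst pgf_Suc_below_1) (auto simp: ennreal_zero_less_mult_iff)
qed simp

text \<open>The recursion is recentred from 0 to 1. The kernel of 1 - \<open>pgf n 0\<close> is
  finite, so its two exponentials cancel, even if the kernel of the excess over 1 is
  infinite.\<close>

lemma pgf_Suc_above_1:
  assumes "1 \<le> z"
  shows "pgf (Suc n) z w = (if is_alive w then z else 1) * enexp_pos 1 (kern (\<lambda>v. pgf n z v - 1) w)"
proof -
  let ?A = "kern (\<lambda>v. 1 - pgf n 0 v) w" and ?B = "kern (\<lambda>v. pgf n z v - 1) w"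
  have "pgf n z v - pgf n 0 v = (1 - pgf n 0 v) + (pgf n z v - 1)" for v
    using pgf_at_0_le_1[of n v] pgf_mono[OF assms, of n v] unfolding pgf_at_1
    by (subst add.commute) (rule ennreal_diff_split)
  then have AB: "kern (\<lambda>v. pgf n z v - pgf n 0 v) w = ?A + ?B"
    by (simp add: kern_add)
  have "?A < \<infinity>"
    by (intro kern_finite pgf_defect_le) auto
  then have "enexp_neg ?A * enexp_pos 1 (?A + ?B) = enexp_pos 1 ?B"
    by (simp add: enexp_pos_add enexp_neg_mult_pos flip: mult.assoc)
  then show ?thesis
    by (simp add: AB mult.assoc)
qed

text \<open>With V = l * \<open>dominating\<close>, the induction needs l * [alive] + Q (exp V - 1)
  \<le> V. Since V \<le> 1, the excess exp V - 1 is at most 2 V, and the linear supersolution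
  inequality closes the step. The bound is independent of n.\<close>

lemma pgf_exp_le:
  assumes "0 \<le> l" and small: "\<And>w. 0 \<le> fst w \<Longrightarrow> ennreal l * dominating w \<le> 1"
    and "0 \<le> fst w"
  shows "pgf n (ennreal (exp l)) w \<le> enexp_pos 1 (ennreal l * dominating w)"
  using \<open>0 \<le> fst w\<close>
proof (induction n arbitrary: w)
  case 0
  then show ?case
    using enexp_pos_mono[of 1 0 "ennreal l * dominating w"] by simp
next
  case (Suc n)
  let ?b = "ennreal (exp l)"
  have "kern (\<lambda>v. pgf n ?b v - 1) w \<le> kern (\<lambda>v. (2 * ennreal l) * dominating v) w"
  proof (intro kern_mono_above)
    fix v :: "real \<times> ereal" assume "fst w < fst v"
    then have v: "0 \<le> fst v"
      using Suc.prems by simp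
    have "pgf n ?b v - 1 \<le> enexp_pos 1 (ennreal l * dominating v) - 1"
      using Suc.IH[OF v] by (rule ennreal_minus_mono) simp
    also have "\<dots> \<le> 2 * (ennreal l * dominating v)"
      by (intro exp_minus_one_le_double small v)
    finally show "pgf n ?b v - 1 \<le> (2 * ennreal l) * dominating v"
      by (simp add: mult.assoc)
  qed
  also have "\<dots> = ennreal l * (2 * kern dominating w)"
    by (simp add: kern_cmult ac_simps)
  finally have K: "kern (\<lambda>v. pgf n ?b v - 1) w \<le> ennreal l * (2 * kern dominating w)" .
  have "pgf (Suc n) ?b w = (if is_alive w then ?b else 1) * enexp_pos 1 (kern (\<lambda>v. pgf n ?b v - 1) w)"
    using assms(1) by (intro pgf_Suc_above_1) (simp flip: ennreal_1)
  also have "\<dots> = enexp_pos 1 (ennreal l * of_bool (is_alive w)) * enexp_pos 1 (kern (\<lambda>v. pgf n ?b v - 1) w)"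
    using assms(1) by (simp add: enexp_pos_ennreal)
  also have "\<dots> = enexp_pos 1 (ennreal l * of_bool (is_alive w) + kern (\<lambda>v. pgf n ?b v - 1) w)"
    by (rule enexp_pos_add[symmetric])
  also have "\<dots> \<le> enexp_pos 1 (ennreal l * of_bool (is_alive w) + ennreal l * (2 * kern dominating w))"
    by (intro enexp_pos_mono add_left_mono K) auto
  also have "\<dots> \<le> enexp_pos 1 (ennreal l * dominating w)"
    unfolding distrib_left[symmetric] by (intro enexp_pos_mono mult_left_mono dominating_supersolution) auto
  finally show ?case .
qed

end

section \<open>Uniqueness of power series and integrals over subalgebras\<close>

text \<open>Coefficients at most 1 make both series converge on the unit interval. If all lower
  coefficients agree, dividing the difference by x^k and letting x tend to 0 isolates the
  coefficient of index k.\<close>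

lemma power_series_unique_ennreal:
  fixes p q :: "nat \<Rightarrow> ennreal"
  assumes le: "\<And>k. p k \<le> 1" "\<And>k. q k \<le> 1"
    and eq: "\<And>z::real. 0 < z \<Longrightarrow> z < 1 \<Longrightarrow> (\<Sum>k. p k * ennreal z ^ k) = (\<Sum>k. q k * ennreal z ^ k)"
  shows "p k = q k"
proof -
  define p' q' where "p' k = enn2real (p k)" and "q' k = enn2real (q k)" for k
  have p': "p k = ennreal (p' k)" "0 \<le> p' k" "p' k \<le> 1" for k
    using le(1)[of k] enn2real_leI[of 1 "p k"] by (auto simp: p'_def ennreal_enn2real_if top_unique)
  have q': "q k = ennreal (q' k)" "0 \<le> q' k" "q' k \<le> 1" for k
    using le(2)[of k] enn2real_leI[of 1 "q k"] by (auto simp: q'_def ennreal_enn2real_if top_unique)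
  have summable: "summable (\<lambda>k. c k * x ^ k)" if "\<And>k. \<bar>c k\<bar> \<le> 1" "\<bar>x\<bar> < 1" for c :: "nat \<Rightarrow> real" and x
  proof (rule summable_comparison_test')
    show "summable (\<lambda>k. \<bar>x\<bar> ^ k)"
      using that by (intro summable_geometric) auto
    show "norm (c k * x ^ k) \<le> \<bar>x\<bar> ^ k" if "0 \<le> k" for k
      using that \<open>\<And>k. \<bar>c k\<bar> \<le> 1\<close>[of k] by (simp add: abs_mult power_abs mult_left_le_one_le)
  qed
  have ps: "(\<Sum>k. ennreal (c k) * ennreal x ^ k) = ennreal (\<Sum>k. c k * x ^ k)"
    if "\<And>k. 0 \<le> c k" "\<And>k. c k \<le> 1" "0 < x" "x < 1" for c :: "nat \<Rightarrow> real" and x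
  proof -
    have "(\<Sum>k. ennreal (c k) * ennreal x ^ k) = (\<Sum>k. ennreal (c k * x ^ k))"
      using that by (simp add: ennreal_mult ennreal_power)
    also have "\<dots> = ennreal (\<Sum>k. c k * x ^ k)"
      using that by (intro suminf_ennreal2 summable) auto
    finally show ?thesis .
  qed
  define d where "d k = p' k - q' k" for k
  have d: "\<bar>d k\<bar> \<le> 1" for k
    using p'[of k] q'[of k] by (auto simp: d_def)
  have zero: "(\<lambda>k. d k * x ^ k) sums 0" if "0 < x" "x < 1" for x
  proof -
    have "ennreal (\<Sum>k. p' k * x ^ k) = ennreal (\<Sum>k. q' k * x ^ k)"
      using eq[OF that] unfolding p'(1) q'(1) ps[OF p'(2,3) that] ps[OF q'(2,3) that] .
    then have "(\<Sum>k. p' k * x ^ k) = (\<Sum>k. q' k * x ^ k)"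
      using p' q' that by (subst (asm) ennreal_inj) (auto intro!: suminf_nonneg summable)
    moreover have "(\<lambda>k. p' k * x ^ k - q' k * x ^ k) sums ((\<Sum>k. p' k * x ^ k) - (\<Sum>k. q' k * x ^ k))"
      using p' q' that by (intro sums_diff summable_sums summable) auto
    ultimately show ?thesis
      by (simp add: d_def left_diff_distrib)
  qed
  have "d k = 0"
  proof (induction k rule: less_induct)
    case (less k)
    define g where "g x = (\<Sum>j. d (j + k) * x ^ j)" for x
    have g: "(\<lambda>j. d (j + k) * x ^ j) sums g x" if "norm x < 1" for x
      unfolding g_def using that d by (intro summable_sums summable) auto
    have "g x = 0" if "0 < x" "x < 1" for x
    proof -
      have "(\<lambda>j. d (j + k) * x ^ (j + k)) sums (0 - (\<Sum>j<k. d j * x ^ j))"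
        using sums_split_initial_segment[OF zero[OF that], of k] by simp
      moreover have "(\<lambda>j. x ^ k * (d (j + k) * x ^ j)) sums (x ^ k * g x)"
        using that by (intro sums_mult g) auto
      ultimately have "x ^ k * g x = 0"
        using less by (simp add: power_add mult_ac sums_iff)
      then show ?thesis
        using that by simp
    qed
    \<comment> \<open>Agreement is known only for positive arguments, hence the one-sided
      limit.\<close>
    then have "\<forall>\<^sub>F x in at_right 0. g x = 0"
      by (subst eventually_at_right[of 0 1]) (auto intro!: exI[of _ 1])
    then have "(g \<longlongrightarrow> 0) (at_right 0)"
      by (rule tendsto_eventually)
    moreover have "(g \<longlongrightarrow> d k) (at_right 0)"
      using powser_limit_0[of 1 "\<lambda>j. d (j + k)" g] g by (simp add: filterlim_at_split)
    ultimately show ?case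
      using tendsto_unique[OF trivial_limit_at_right_real] by blast
  qed
  then show ?thesis
    using p' q' by (simp add: d_def)
qed

lemma AE_eq_1_if_nn_integral_eq_1:
  assumes "prob_space M" and le: "\<And>\<omega>. h \<omega> \<le> 1" and int: "(\<integral>\<^sup>+\<omega>. h \<omega> \<partial>M) = 1"
  shows "AE \<omega> in M. h \<omega> = 1"
proof -
  interpret prob_space M by fact
  (* h need not be measurable: its integral is the supremum over simple functions below it *)
  let ?S = "{g. simple_function M g \<and> g \<le> h}"
  have "(\<lambda>_. 0) \<in> ?S"
    by (auto simp: le_fun_def)
  then have "?S \<noteq> {}"
    by blast
  from ennreal_SUP_countable_SUP[OF this, of "integral\<^sup>S M"]
  obtain g :: "nat \<Rightarrow> ennreal" where g: "range g \<subseteq> integral\<^sup>S M ` ?S" "(SUP u\<in>?S. integral\<^sup>S M u) = (SUP i. g i)"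
    by blast
  then have "\<forall>i. \<exists>u. simple_function M u \<and> u \<le> h \<and> g i = integral\<^sup>S M u"
    by (force simp: image_subset_iff)
  then obtain u where u: "\<And>i. simple_function M (u i)" "\<And>i. u i \<le> h" "\<And>i. g i = integral\<^sup>S M (u i)"
    by metis
  define v where "v \<omega> = (SUP i. u i \<omega>)" for \<omega>
  have [measurable]: "v \<in> borel_measurable M"
    unfolding v_def using u(1) by (intro borel_measurable_SUP) (auto intro: borel_measurable_simple_function)
  have vh: "v \<omega> \<le> h \<omega>" for \<omega>
    using u(2) by (auto simp: v_def le_fun_def intro!: SUP_least)
  have "1 = (SUP i. g i)"
    using int g(2) by (simp add: nn_integral_def)
  also have "\<dots> \<le> (\<integral>\<^sup>+\<omega>. v \<omega> \<partial>M)"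
  proof (intro SUP_least)
    fix i
    have "g i = (\<integral>\<^sup>+\<omega>. u i \<omega> \<partial>M)"
      using u by (simp add: nn_integral_eq_simple_integral)
    also have "\<dots> \<le> (\<integral>\<^sup>+\<omega>. v \<omega> \<partial>M)"
      by (intro nn_integral_mono) (auto simp: v_def intro: SUP_upper)
    finally show "g i \<le> (\<integral>\<^sup>+\<omega>. v \<omega> \<partial>M)" .
  qed
  finally have ge: "1 \<le> (\<integral>\<^sup>+\<omega>. v \<omega> \<partial>M)" .
  have v1: "v \<omega> \<le> 1" for \<omega>
    using vh le order_trans by blast
  have "(\<integral>\<^sup>+\<omega>. v \<omega> \<partial>M) \<le> (\<integral>\<^sup>+\<omega>. 1 \<partial>M)"
    by (intro nn_integral_mono v1)
  then have "(\<integral>\<^sup>+\<omega>. v \<omega> \<partial>M) \<noteq> \<infinity>"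
    by (auto simp: emeasure_space_1 top_unique)
  then have "(\<integral>\<^sup>+\<omega>. 1 - v \<omega> \<partial>M) = (\<integral>\<^sup>+\<omega>. 1 \<partial>M) - (\<integral>\<^sup>+\<omega>. v \<omega> \<partial>M)"
    by (intro nn_integral_diff AE_I2 v1) auto
  also have "\<dots> = 0"
    using ge by (simp add: emeasure_space_1 diff_eq_0_ennreal)
  finally have "AE \<omega> in M. 1 - v \<omega> = 0"
    by (subst (asm) nn_integral_0_iff_AE) auto
  then show ?thesis
  proof eventually_elim
    case (elim \<omega>)
    then have "1 \<le> v \<omega>"
      using v1[of \<omega>] by (metis diff_add_cancel_ennreal add_0 order_refl)
    then show ?case
      using vh[of \<omega>] le[of \<omega>] by (meson order_trans antisym)
  qed
qed

text \<open>Testing against all events of F says that the measures with densities H1 and H2 agree on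
  F; integrating an F-measurable Y against both gives the claim. This plays the part of conditional
  expectation.\<close>

lemma nn_integral_weighted_eq:
  assumes sub: "subalgebra M F"
    and [measurable]: "H1 \<in> borel_measurable M" "H2 \<in> borel_measurable M"
    and eq: "\<And>E. E \<in> sets F \<Longrightarrow> (\<integral>\<^sup>+\<omega>. indicator E \<omega> * H1 \<omega> \<partial>M) = (\<integral>\<^sup>+\<omega>. indicator E \<omega> * H2 \<omega> \<partial>M)"
    and Y: "Y \<in> borel_measurable F"
  shows "(\<integral>\<^sup>+\<omega>. Y \<omega> * H1 \<omega> \<partial>M) = (\<integral>\<^sup>+\<omega>. Y \<omega> * H2 \<omega> \<partial>M)"
proof -
  have subd: "subalgebra (density M H) F" for H
    using sub by (simp add: subalgebra_def)
  have YM [measurable]: "Y \<in> borel_measurable M"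
    using sub Y by (rule measurable_from_subalg)
  have "restr_to_subalg (density M H1) F = restr_to_subalg (density M H2) F"
  proof (rule measure_eqI)
    fix E assume "E \<in> sets (restr_to_subalg (density M H1) F)"
    then have E: "E \<in> sets F"
      using subd by (simp add: sets_restr_to_subalg)
    then have [measurable]: "E \<in> sets M"
      using sub by (auto simp: subalgebra_def)
    show "emeasure (restr_to_subalg (density M H1) F) E = emeasure (restr_to_subalg (density M H2) F) E"
      using eq[OF E] by (simp add: emeasure_restr_to_subalg[OF subd E] emeasure_density mult.commute)
  qed (simp add: sets_restr_to_subalg subd)
  then have "(\<integral>\<^sup>+\<omega>. Y \<omega> \<partial>density M H1) = (\<integral>\<^sup>+\<omega>. Y \<omega> \<partial>density M H2)"
    by (metis nn_integral_subalgebra2[OF subd Y])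
  then show ?thesis
    by (simp add: nn_integral_density mult.commute)
qed

section \<open>Excursions and point configurations\<close>

lemma space_exc_M [simp]: "space exc_M = Exc"
  by (simp add: exc_M_def space_restrict_space space_pair_measure path_M_def space_PiM)

lemma measurable_exc_M:
  "f \<in> measurable (borel \<Otimes>\<^sub>M (borel \<Otimes>\<^sub>M path_M)) K \<Longrightarrow> f \<in> measurable exc_M K"
  unfolding exc_M_def by (rule measurable_restrict_space1)

lemma exc_start_measurable [measurable]: "exc_start \<in> borel_measurable exc_M"
  unfolding exc_start_def by (rule measurable_exc_M) measurable

lemma exc_end_measurable [measurable]: "exc_end \<in> borel_measurable exc_M"
  unfolding exc_end_def by (rule measurable_exc_M) measurable

lemma exc_path_measurable [measurable]: "(\<lambda>w. exc_path w r) \<in> borel_measurable exc_M"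
proof -
  have "(\<lambda>w. snd (snd w) r) \<in> borel_measurable ((borel :: real measure) \<Otimes>\<^sub>M ((borel :: ereal measure) \<Otimes>\<^sub>M path_M))"
    unfolding path_M_def by measurable
  then show ?thesis
    unfolding exc_path_def by (rule measurable_exc_M)
qed

lemma Theta_in_Exc:
  assumes "v \<in> Exc"
  shows "Theta w \<tau> v \<in> Exc"
proof -
  obtain s e y where v: "v = (s, e, y)"
    by (cases v)
  have y: "ereal s < e" "continuous_on UNIV y" "\<And>r. r \<le> s \<Longrightarrow> y r = y s"
      "\<And>r. e \<le> ereal r \<Longrightarrow> y r = y (real_of_ereal e)"
    using assms unfolding v Exc_def mem_Collect_eq split_conv by blast+
  have "continuous_on UNIV (\<lambda>r. y (r - \<tau>) + exc_path w \<tau>)"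
    by (intro continuous_intros continuous_on_compose2[OF y(2)]) auto
  moreover have "ereal (s + \<tau>) < e + ereal \<tau>"
    using y(1) by (cases e) auto
  moreover have "y (r - \<tau>) = y (s + \<tau> - \<tau>)" if "r \<le> s + \<tau>" for r
    using y(3)[of "r - \<tau>"] that by simp
  moreover have "y (r - \<tau>) = y (real_of_ereal (e + ereal \<tau>) - \<tau>)" if "e + ereal \<tau> \<le> ereal r" for r
    using y(1) y(4)[of "r - \<tau>"] that by (cases e) auto
  ultimately show ?thesis
    by (auto simp: Theta_def Exc_def v exc_start_def exc_end_def exc_path_def)
qed

text \<open>The level set is closed, so the infimum defining the hitting time is attained; as y
  vanishes at 0 and c does not, it is strictly positive. The killed path is y evaluated at min r h,
  hence continuous.\<close>

lemma kill_in_Exc: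
  assumes y: "continuous_on UNIV y" "\<And>r. r \<le> 0 \<Longrightarrow> y r = 0" and "c \<noteq> 0"
  shows "kill c y \<in> Exc"
proof (cases "{\<tau>. 0 \<le> \<tau> \<and> y \<tau> = c} = {}")
  case True
  then have "hit_time c y = \<infinity>"
    by (simp add: hit_time_def)
  then show ?thesis
    using y by (auto simp: kill_def Exc_def)
next
  case False
  let ?S = "{\<tau>. 0 \<le> \<tau> \<and> y \<tau> = c}"
  define h where "h = Inf ?S"
  have "closed ({0..} \<inter> y -` {c})"
    by (intro closed_Int continuous_closed_vimage) (use y(1) in \<open>auto simp: continuous_on_eq_continuous_at\<close>)
  also have "{0..} \<inter> y -` {c} = ?S"
    by auto
  finally have "h \<in> ?S"
    unfolding h_def using False by (intro closed_contains_Inf) (auto intro!: bdd_belowI)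
  then have h: "0 < h"
    using y(2)[of 0] \<open>c \<noteq> 0\<close> by (cases "h = 0") auto
  have hit: "hit_time c y = ereal h"
    using False by (simp add: hit_time_def h_def)
  have "continuous_on UNIV (\<lambda>r. y (min r h))"
    by (intro continuous_on_compose2[OF y(1)] continuous_intros) auto
  also have "(\<lambda>r. y (min r h)) = (\<lambda>r. if r \<le> h then y r else y h)"
    by (auto simp: min_def)
  finally show ?thesis
    using h y(2) unfolding kill_def hit real_of_ereal.simps by (auto simp: Exc_def)
qed

section \<open>The lifetime under Ito's measure\<close>

lemma nn_integral_entrance:
  assumes "0 < r"
  shows "(\<integral>\<^sup>+ y. indicator ({0<..}) y * ennreal (entrance r y) \<partial>lborel) = ennreal (2 / sqrt (2 * pi) / sqrt r)"
proof -
  let ?F = "\<lambda>y. - (2 / sqrt (2 * pi * r)) * exp (- y\<^sup>2 / (2 * r))"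
  have "(\<integral>\<^sup>+ y. indicator ({0<..}) y * ennreal (entrance r y) \<partial>lborel) =
      (\<integral>\<^sup>+ y. ennreal (entrance r y) * indicator {0..} y \<partial>lborel)"
    by (intro nn_integral_cong) (auto simp: indicator_def entrance_def)
  also have "\<dots> = ennreal (- (2 / sqrt (2 * pi * r)) * 0 - ?F 0)"
  proof (rule nn_integral_FTC_atLeast)
    show "(?F has_real_derivative entrance r y) (at y)" for y
      using assms by (auto intro!: derivative_eq_intros simp: entrance_def heat_def field_simps power2_eq_square)
    have "filterlim (\<lambda>y::real. - y\<^sup>2 / (2 * r)) at_bot at_top"
    proof -
      have "filterlim (\<lambda>y::real. y\<^sup>2) at_top at_top"
        by (intro filterlim_pow_at_top filterlim_ident) auto
      then have "filterlim (\<lambda>y::real. - (1 / (2 * r)) * y\<^sup>2) at_bot at_top"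
        using assms by (intro filterlim_tendsto_neg_mult_at_bot[OF tendsto_const]) auto
      then show ?thesis
        by simp
    qed
    then show "(?F \<longlongrightarrow> - (2 / sqrt (2 * pi * r)) * 0) at_top"
      by (intro tendsto_mult tendsto_const filterlim_compose[OF exp_at_bot])
  qed (use assms in \<open>auto simp: entrance_def heat_def\<close>)
  finally show ?thesis
    by (simp add: real_sqrt_mult)
qed

definition lifetime_law :: "exc measure \<Rightarrow> real measure" where
  "lifetime_law Q = distr Q borel (\<lambda>v. real_of_ereal (exc_end v))"

lemma ito_AE:
  assumes "is_ito Q"
  shows "AE v in Q. exc_start v = 0 \<and> (\<exists>e>0. exc_end v = ereal e \<and> (\<forall>r. 0 < exc_path v r \<longleftrightarrow> 0 < r \<and> r < e))"
proof -
  have sp: "space Q = Exc"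
    using assms sets_eq_imp_space_eq[of Q exc_M] by (simp add: is_ito_def)
  have "AE w in Q. exc_start w = 0 \<and> exc_end w < \<infinity> \<and>
        (\<forall>\<tau>. exc_path w \<tau> > 0 \<longleftrightarrow> (0 < \<tau> \<and> ereal \<tau> < exc_end w))"
    using assms unfolding is_ito_def by auto
  then show ?thesis
    using AE_space
  proof eventually_elim
    case (elim v)
    then have "ereal (exc_start v) < exc_end v"
      by (auto simp: sp Exc_def exc_start_def exc_end_def)
    with elim show ?case
      by (cases "exc_end v") auto
  qed
qed

text \<open>Almost everywhere, the lifetime exceeds r exactly when the path is positive at r, so the
  tail is the total mass of the entrance law at time r. Its value 2 / sqrt (2 pi r) is the integral
  of the density s^(-3/2) / sqrt (2 pi) over s > r.\<close>

lemma lifetime_law_fan_kernel: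
  assumes ito: "is_ito Q" and "0 < a"
  shows "fan_kernel a (2 / sqrt (2 * pi)) (lifetime_law Q)"
proof
  have sets [measurable_cong]: "sets Q = sets exc_M"
    using ito by (simp add: is_ito_def)
  have sp: "space Q = Exc"
    using sets_eq_imp_space_eq[OF sets] by simp
  show "0 < a" "0 < 2 / sqrt (2 * pi)" "sets (lifetime_law Q) = sets borel"
    using assms by (auto simp: lifetime_law_def)
  have "emeasure (lifetime_law Q) {..0} = emeasure Q {v \<in> space Q. real_of_ereal (exc_end v) \<in> {..0}}"
    unfolding lifetime_law_def by (subst emeasure_distr) (auto intro!: arg_cong[where f = "emeasure Q"])
  also have "\<dots> = 0"
  proof -
    have "AE v in Q. \<not> (real_of_ereal (exc_end v) \<in> {..0})"
      using ito_AE[OF ito]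
    proof eventually_elim
      case (elim v)
      then obtain e where "0 < e" "exc_end v = ereal e"
        by blast
      then show ?case
        by simp
    qed
    then show ?thesis
      by (subst (asm) AE_iff_measurable[OF _ refl]) simp_all
  qed
  finally show "emeasure (lifetime_law Q) {..0} = 0" .
  fix r :: real assume r: "0 < r"
  have "emeasure (lifetime_law Q) {r<..} = emeasure Q {v \<in> space Q. real_of_ereal (exc_end v) \<in> {r<..}}"
    unfolding lifetime_law_def by (subst emeasure_distr) (auto intro!: arg_cong[where f = "emeasure Q"])
  also have "\<dots> = emeasure Q {v \<in> space Q. 0 < exc_path v r}"
  proof (rule emeasure_eq_AE)
    show "AE v in Q. v \<in> {v \<in> space Q. real_of_ereal (exc_end v) \<in> {r<..}} \<longleftrightarrow> v \<in> {v \<in> space Q. 0 < exc_path v r}"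
      using ito_AE[OF ito]
    proof eventually_elim
      case (elim v)
      then obtain e where "exc_end v = ereal e" "0 < exc_path v r \<longleftrightarrow> 0 < r \<and> r < e"
        by blast
      then show ?case
        using r by simp
    qed
  qed measurable
  also have "\<dots> = fdd_Q [(r, UNIV)]"
  proof -
    have *: "emeasure Q {w\<in>space exc_M. \<forall>tb\<in>set tbs. exc_path w (fst tb) \<in> snd tb \<and> 0 < exc_path w (fst tb)} = fdd_Q tbs"
      if "tbs \<noteq> []" "sorted_wrt (<) (map fst tbs)" "0 < fst (hd tbs)" "\<forall>tb\<in>set tbs. snd tb \<in> sets borel" for tbs
      using ito that unfolding is_ito_def by blast
    show ?thesis
      using *[of "[(r, UNIV)]"] r by (simp add: sp)
  qed
  also have "\<dots> = ennreal (2 / sqrt (2 * pi) / sqrt r)"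
    using nn_integral_entrance[OF r] by (simp add: fdd_Q_def)
  finally show "emeasure (lifetime_law Q) {r<..} \<le> ennreal (2 / sqrt (2 * pi) / sqrt r)"
    by simp
qed

definition exc_span :: "exc \<Rightarrow> real \<times> ereal" where
  "exc_span w = (exc_start w, exc_end w)"

lemma exc_span_measurable [measurable]: "exc_span \<in> measurable exc_M (borel \<Otimes>\<^sub>M borel)"
  unfolding exc_span_def by measurable

text \<open>Almost every excursion starts at 0 and ends at a finite time e, so its translate has
  span (\<tau>, \<tau> + e) whatever the spatial shift.\<close>

lemma kern_int_exc_span:
  assumes ito: "is_ito Q" and "0 < a"
    and g [measurable]: "g \<in> borel_measurable (borel \<Otimes>\<^sub>M borel)"
  shows "kern_int a Q w (\<lambda>v. g (exc_span v)) = fan_kernel.kern a (lifetime_law Q) g (exc_span w)"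
proof -
  interpret fan_kernel a "2 / sqrt (2 * pi)" 0 "lifetime_law Q"
    using assms by (intro lifetime_law_fan_kernel)
  have sets [measurable_cong]: "sets Q = sets exc_M"
    using ito by (simp add: is_ito_def)
  have "(\<integral>\<^sup>+ v. g (exc_span (Theta w \<tau> v)) \<partial>Q) = (\<integral>\<^sup>+ \<sigma>. g (\<tau>, ereal (\<tau> + \<sigma>)) \<partial>lifetime_law Q)" for \<tau>
  proof -
    have "(\<integral>\<^sup>+ v. g (exc_span (Theta w \<tau> v)) \<partial>Q) = (\<integral>\<^sup>+ v. g (\<tau>, ereal (\<tau> + real_of_ereal (exc_end v))) \<partial>Q)"
    proof (rule nn_integral_cong_AE)
      show "AE v in Q. g (exc_span (Theta w \<tau> v)) = g (\<tau>, ereal (\<tau> + real_of_ereal (exc_end v)))"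
        using ito_AE[OF ito]
      proof eventually_elim
        case (elim v)
        then obtain e where e: "exc_end v = ereal e" and s: "exc_start v = 0"
          by blast
        have "exc_span (Theta w \<tau> v) = (exc_start v + \<tau>, exc_end v + ereal \<tau>)"
          by (simp add: exc_span_def Theta_def exc_start_def exc_end_def)
        then show ?case
          unfolding e s by (simp add: add.commute)
      qed
    qed
    also have "\<dots> = (\<integral>\<^sup>+ \<sigma>. g (\<tau>, ereal (\<tau> + \<sigma>)) \<partial>lifetime_law Q)"
      unfolding lifetime_law_def by (subst nn_integral_distr) auto
    finally show ?thesis .
  qed
  then show ?thesis
    unfolding kern_int_def kern_def by (simp add: exc_span_def)
qed

section \<open>Integrals against point configurations\<close>

lemma cint_add: "cint m (\<lambda>w. f w + g w) = cint m f + cint m g"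
  unfolding cint_def by (simp add: distrib_left nn_integral_add)

lemma cint_cmult: "cint m (\<lambda>w. c * f w) = c * cint m f"
  unfolding cint_def by (simp add: mult.left_commute[of _ c] nn_integral_cmult)

lemma cint_SUP:
  assumes "incseq (f :: nat \<Rightarrow> exc \<Rightarrow> ennreal)"
  shows "cint m (\<lambda>w. SUP i. f i w) = (SUP i. cint m (f i))"
proof -
  have "incseq (\<lambda>i w. of_nat (m w) * f i w)"
    using assms by (auto simp: incseq_def le_fun_def intro!: mult_left_mono)
  then have "(\<integral>\<^sup>+ w. (SUP i. of_nat (m w) * f i w) \<partial>count_space UNIV) = (SUP i. cint m (f i))"
    unfolding cint_def by (intro nn_integral_monotone_convergence_SUP) auto
  then show ?thesis
    unfolding cint_def by (simp add: SUP_mult_left_ennreal)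
qed

lemma cint_single: "cint (\<lambda>w. if w = x then 1 else 0) f = f x"
proof -
  have "cint (\<lambda>w. if w = x then 1 else 0) f = (\<integral>\<^sup>+ w. f x * indicator {x} w \<partial>count_space UNIV)"
    unfolding cint_def by (intro nn_integral_cong) (auto simp: indicator_def)
  then show ?thesis
    by (simp add: nn_integral_cmult_indicator)
qed

lemma cint_cong_off_null:
  assumes "cnt m (- S) = 0" "\<And>w. w \<in> S \<Longrightarrow> f w = g w"
  shows "cint m f = cint m g"
proof -
  have "m w = 0" if "w \<notin> S" for w
    using assms(1) that unfolding cnt_def cint_def
    by (simp add: nn_integral_0_iff_AE AE_count_space indicator_def del: split_paired_All) blast
  then show ?thesis
    unfolding cint_def using assms(2) by (intro nn_integral_cong) (metis mult_zero_left of_nat_0)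
qed

lemma cnt_nat_or_top: "cnt m A = \<infinity> \<or> (\<exists>n::nat. cnt m A = of_nat n)"
proof (cases "finite {w \<in> A. m w \<noteq> 0}")
  case True
  have "cnt m A = (\<Sum>w\<in>{w \<in> A. m w \<noteq> 0}. of_nat (m w) * indicator A w)"
    unfolding cnt_def cint_def using True by (intro nn_integral_count_space') (auto simp: indicator_def)
  also have "\<dots> = of_nat (\<Sum>w\<in>{w \<in> A. m w \<noteq> 0}. m w)"
    by (simp add: indicator_def)
  finally show ?thesis
    by blast
next
  case False
  have "(\<integral>\<^sup>+ w. indicator {w \<in> A. m w \<noteq> 0} w \<partial>count_space UNIV) \<le> cnt m A"
    unfolding cnt_def cint_def
  proof (intro nn_integral_mono)
    fix w
    have "(1::ennreal) \<le> of_nat (m w)" if "m w \<noteq> 0"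
      using that of_nat_mono[of 1 "m w", where 'a = ennreal] by simp
    then show "indicator {w \<in> A. m w \<noteq> 0} w \<le> (of_nat (m w) * indicator A w :: ennreal)"
      by (auto simp: indicator_def)
  qed
  then show ?thesis
    using False by (simp add: top_unique)
qed

lemma nat_or_top_sum:
  fixes x :: "nat \<Rightarrow> ennreal"
  assumes "\<And>i. x i = \<infinity> \<or> (\<exists>n::nat. x i = of_nat n)"
  shows "(\<Sum>i<k. x i) = \<infinity> \<or> (\<exists>n::nat. (\<Sum>i<k. x i) = of_nat n)"
proof (induction k)
  case (Suc k)
  then show ?case
    using assms[of k] by (auto simp flip: of_nat_add)
qed (auto intro: exI[of _ 0])

lemma suminf_of_bool_power:
  "(\<Sum>k. of_bool (of_nat n = (of_nat k :: ennreal)) * z ^ k) = (z ^ n :: ennreal)"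
  using suminf_finite[of "{n}" "\<lambda>k. of_bool (of_nat n = (of_nat k :: ennreal)) * z ^ k"] by auto

lemma enexp_neg_nat:
  assumes "0 \<le> \<theta>"
  shows "enexp_neg (ennreal \<theta> * of_nat n) = ennreal (exp (- \<theta>)) ^ n"
proof -
  have "ennreal \<theta> * of_nat n = ennreal (real n * \<theta>)"
    using assms by (simp add: ennreal_of_nat_eq_real_of_nat ennreal_mult mult.commute)
  then have "enexp_neg (ennreal \<theta> * of_nat n) = ennreal (exp (real n * - \<theta>))"
    using assms by (simp add: enexp_neg_ennreal)
  then show ?thesis
    by (simp only: exp_of_nat_mult ennreal_power exp_ge_zero)
qed

lemma enexp_pos_nat: "enexp_pos c (of_nat n) = ennreal (exp c) ^ n"
proof -
  have "enexp_pos c (of_nat n) = ennreal (exp (real n * c))"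
    by (simp add: ennreal_of_nat_eq_real_of_nat enexp_pos_ennreal mult.commute)
  then show ?thesis
    by (simp only: exp_of_nat_mult ennreal_power exp_ge_zero)
qed

section \<open>Exponential moments of the Brownian fan\<close>

locale brownian_fan =
  fixes a :: real and Q :: "exc measure" and M :: "'o measure"
    and X :: "'o \<Rightarrow> real \<Rightarrow> real" and L :: "'o \<Rightarrow> real" and N :: "nat \<Rightarrow> 'o \<Rightarrow> exc \<Rightarrow> nat"
    and t :: real
  assumes intensity_pos: "0 < a" and ito: "is_ito Q" and fan: "is_brownian_fan a Q M X L N"
begin

sublocale fan_kernel a "2 / sqrt (2 * pi)" t "lifetime_law Q"
  using ito intensity_pos by (rule lifetime_law_fan_kernel)

sublocale prob_space M
  using fan by (simp add: is_brownian_fan_def is_BM_def)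

abbreviation root :: "'o \<Rightarrow> exc" where
  "root \<omega> \<equiv> kill (- L \<omega>) (X \<omega>)"

lemma N_0: "\<omega> \<in> space M \<Longrightarrow> N 0 \<omega> = (\<lambda>w. if w = root \<omega> then 1 else 0)"
  using fan by (simp add: is_brownian_fan_def)

lemma cnt_measurable: "A \<in> sets exc_M \<Longrightarrow> (\<lambda>\<omega>. cnt (N k \<omega>) A) \<in> borel_measurable M"
  using fan by (simp add: is_brownian_fan_def)

lemma laplace_functional:
  assumes "f \<in> borel_measurable exc_M" "\<And>w. 0 \<le> f w" "E \<in> gen_sigma M N (Suc n)"
  shows "(\<integral>\<^sup>+ \<omega>. indicator E \<omega> * enexp_neg (cint (N (Suc n) \<omega>) (\<lambda>w. ennreal (f w))) \<partial>M)
    = (\<integral>\<^sup>+ \<omega>. indicator E \<omega> * enexp_neg (cint (N n \<omega>)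
        (\<lambda>w. kern_int a Q w (\<lambda>v. ennreal (1 - exp (- f v))))) \<partial>M)"
proof -
  have "\<forall>n f E. 1 \<le> n \<longrightarrow> f \<in> borel_measurable exc_M \<longrightarrow> (\<forall>w. 0 \<le> f w) \<longrightarrow>
        E \<in> gen_sigma M N n \<longrightarrow>
        (\<integral>\<^sup>+ \<omega>. indicator E \<omega> * enexp_neg (cint (N n \<omega>) (\<lambda>w. ennreal (f w))) \<partial>M)
        = (\<integral>\<^sup>+ \<omega>. indicator E \<omega> *
              enexp_neg (cint (N (n - 1) \<omega>)
                 (\<lambda>w. kern_int a Q w (\<lambda>v. ennreal (1 - exp (- f v))))) \<partial>M)"
    using fan unfolding is_brownian_fan_def by blast
  from this[rule_format, of "Suc n" f E] assms show ?thesis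
    by simp
qed

lemma AE_root_in_Exc: "AE \<omega> in M. root \<omega> \<in> Exc"
proof -
  have "distributed M lborel L (exponential_density (1 / a))"
    using fan by (simp add: is_brownian_fan_def)
  moreover have "AE x in lborel. 0 < ennreal (exponential_density (1 / a) x) \<longrightarrow> 0 < x"
    using AE_lborel_singleton[of "0::real"]
    by eventually_elim (auto simp: exponential_density_def)
  ultimately have "AE \<omega> in M. 0 < L \<omega>"
    by (subst distributed_AE2[where N = lborel and X = L and P = "\<lambda>x. 0 < x"]) auto
  then show ?thesis
    using AE_space
  proof eventually_elim
    case (elim \<omega>)
    have "continuous_on UNIV (X \<omega>)" "\<And>\<tau>. \<tau> \<le> 0 \<Longrightarrow> X \<omega> \<tau> = 0"
      using fan elim by (auto simp: is_brownian_fan_def is_BM_def)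
    then show ?case
      using elim by (intro kill_in_Exc) auto
  qed
qed

lemma AE_cnt_compl_Exc: "AE \<omega> in M. cnt (N n \<omega>) (- Exc) = 0"
proof (cases n)
  case 0
  show ?thesis
    using AE_root_in_Exc AE_space
    by eventually_elim (simp add: 0 N_0 cnt_def cint_single)
next
  case (Suc m)
  have space_Q: "space Q = Exc"
    using ito sets_eq_imp_space_eq[of Q exc_M] by (simp add: is_ito_def)
  let ?f = "indicator (- Exc) :: exc \<Rightarrow> real"
  have kern0: "kern_int a Q w (\<lambda>v. ennreal (1 - exp (- ?f v))) = 0" for w
  proof -
    have "(\<integral>\<^sup>+ v. ennreal (1 - exp (- ?f (Theta w \<tau> v))) \<partial>Q) = (\<integral>\<^sup>+ v. 0 \<partial>Q)" for \<tau>
      by (intro nn_integral_cong) (simp add: space_Q Theta_in_Exc)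
    then show ?thesis
      by (simp add: kern_int_def)
  qed
  have "?f \<in> borel_measurable exc_M"
    by (subst measurable_cong[where g = "\<lambda>_. 0"]) auto
  moreover have "space M \<in> gen_sigma M N (Suc m)"
    unfolding gen_sigma_def by (rule sigma_sets_top)
  ultimately have "(\<integral>\<^sup>+ \<omega>. indicator (space M) \<omega> * enexp_neg (cint (N (Suc m) \<omega>) (\<lambda>w. ennreal (?f w))) \<partial>M)
     = (\<integral>\<^sup>+ \<omega>. indicator (space M) \<omega> * enexp_neg (cint (N m \<omega>) (\<lambda>w. 0)) \<partial>M)"
    by (subst laplace_functional) (simp_all add: kern0)
  also have "\<dots> = 1"
    by (simp add: cint_def emeasure_space_1)
  finally have "AE \<omega> in M. indicator (space M) \<omega> * enexp_neg (cint (N (Suc m) \<omega>) (\<lambda>w. ennreal (?f w))) = 1"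
    by (intro AE_eq_1_if_nn_integral_eq_1 prob_space_axioms)
       (auto simp: indicator_def enexp_neg_le_1)
  then show ?thesis
    using AE_space
  proof eventually_elim
    case (elim \<omega>)
    then have "enexp_neg (cnt (N n \<omega>) (- Exc)) = 1"
      by (simp add: cnt_def Suc ennreal_indicator)
    then show ?case
      by (auto simp: enexp_neg_def enn2real_eq_0_iff split: if_splits)
  qed
qed

text \<open>Measurability on \<open>exc_M\<close> controls f only on \<open>Exc\<close>; the cut-off
  makes the integral a random variable, without changing it almost surely.\<close>

definition cint_Exc :: "nat \<Rightarrow> (exc \<Rightarrow> ennreal) \<Rightarrow> 'o \<Rightarrow> ennreal" where
  "cint_Exc n f \<omega> = cint (N n \<omega>) (\<lambda>w. f w * indicator Exc w)"

lemma cint_Exc_measurable [measurable]: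
  assumes "f \<in> borel_measurable exc_M"
  shows "cint_Exc n f \<in> borel_measurable M"
  using assms
proof (induction rule: borel_measurable_induct)
  case (cong f g)
  have "cint_Exc n f = cint_Exc n g"
    unfolding cint_Exc_def using cong(3) by (intro ext arg_cong2[where f = cint]) (auto simp: indicator_def)
  then show ?case
    using cong by simp
next
  case (set A)
  have "A \<subseteq> Exc"
    using sets.sets_into_space[OF set] by simp
  then have "(\<lambda>w. indicator A w * indicator Exc w) = (indicator A :: exc \<Rightarrow> ennreal)"
    by (auto simp: fun_eq_iff indicator_def)
  then have "cint_Exc n (indicator A) = (\<lambda>\<omega>. cnt (N n \<omega>) A)"
    by (simp add: cint_Exc_def[abs_def] cnt_def)
  then show ?case
    using set cnt_measurable by simp
next
  case (mult f c)
  have "cint_Exc n (\<lambda>x. c * f x) = (\<lambda>\<omega>. c * cint_Exc n f \<omega>)"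
    by (simp add: cint_Exc_def[abs_def] mult.assoc cint_cmult)
  then show ?case
    using mult by simp
next
  case (add f g)
  have "cint_Exc n (\<lambda>x. g x + f x) = (\<lambda>\<omega>. cint_Exc n g \<omega> + cint_Exc n f \<omega>)"
    by (simp add: cint_Exc_def[abs_def] distrib_right cint_add)
  then show ?case
    using add by simp
next
  case (seq U)
  have "incseq (\<lambda>i w. U i w * indicator Exc w)"
    using seq by (auto simp: incseq_def le_fun_def intro!: mult_right_mono)
  from cint_SUP[OF this] have eq: "cint_Exc n (SUP i. U i) = (\<lambda>\<omega>. SUP i. cint_Exc n (U i) \<omega>)"
    by (simp add: cint_Exc_def[abs_def] SUP_mult_right_ennreal image_comp)
  show ?case
    unfolding eq using seq by (intro borel_measurable_SUP) auto
qed

lemma cint_Exc_AE_eq: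
  assumes "\<And>w. w \<in> Exc \<Longrightarrow> f w = g w"
  shows "AE \<omega> in M. cint (N n \<omega>) f = cint_Exc n g \<omega>"
  using AE_cnt_compl_Exc[of n]
proof eventually_elim
  case (elim \<omega>)
  show ?case
    unfolding cint_Exc_def by (rule cint_cong_off_null[OF elim]) (simp add: assms)
qed

definition alive_set :: "exc set" where
  "alive_set = {w \<in> Exc. is_alive (exc_span w)}"

lemma alive_set_measurable [measurable]: "alive_set \<in> sets exc_M"
proof -
  have "{w \<in> space exc_M. is_alive (exc_span w)} \<in> sets exc_M"
    by measurable
  then show ?thesis
    by (simp add: alive_set_def)
qed

definition population :: "nat \<Rightarrow> 'o \<Rightarrow> ennreal" where
  "population n \<omega> = (\<Sum>k<n. cnt (N k \<omega>) alive_set)"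

lemma population_measurable [measurable]: "population n \<in> borel_measurable M"
  unfolding population_def[abs_def] by (intro borel_measurable_sum cnt_measurable) auto

text \<open>The sigma-algebra \<open>gen_sigma\<close> as a measure space, so that one can speak of
  functions measurable with respect to the generations before n.\<close>

definition history :: "nat \<Rightarrow> 'o measure" where
  "history n = sigma (space M)
     {{\<omega>\<in>space M. cnt (N k \<omega>) A \<in> B} | k A B. k < n \<and> A \<in> sets exc_M \<and> B \<in> sets borel}"

lemma sets_history: "sets (history n) = gen_sigma M N n"
  unfolding history_def gen_sigma_def by (rule sets_measure_of) auto

lemma space_history: "space (history n) = space M"
  unfolding history_def by (rule space_measure_of) auto

lemma subalgebra_history: "subalgebra M (history n)"
proof -
  have "{\<omega>\<in>space M. cnt (N k \<omega>) A \<in> B} \<in> sets M" if "A \<in> sets exc_M" "B \<in> sets borel" for k A B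
    using measurable_sets[OF cnt_measurable[OF that(1)] that(2), of k] by (simp add: vimage_def Int_def conj_commute)
  then have "gen_sigma M N n \<subseteq> sets M"
    unfolding gen_sigma_def by (intro sets.sigma_sets_subset) auto
  then show ?thesis
    by (simp add: subalgebra_def space_history sets_history)
qed

lemma population_measurable_history: "population n \<in> borel_measurable (history n)"
proof -
  have "(\<lambda>\<omega>. cnt (N k \<omega>) A) \<in> borel_measurable (history n)" if "k < n" "A \<in> sets exc_M" for k A
  proof (rule measurableI)
    fix B :: "ennreal set" assume "B \<in> sets borel"
    then have "{\<omega>\<in>space M. cnt (N k \<omega>) A \<in> B} \<in> gen_sigma M N n"
      unfolding gen_sigma_def using that by (intro sigma_sets.Basic) blast
    then show "(\<lambda>\<omega>. cnt (N k \<omega>) A) -` B \<inter> space (history n) \<in> sets (history n)"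
      by (simp add: sets_history space_history vimage_def Int_def conj_commute)
  qed simp
  then show ?thesis
    unfolding population_def[abs_def] by (intro borel_measurable_sum) auto
qed

text \<open>The Laplace functional takes test functions f through exp (-f), so the generating
  function at z = exp (-\<theta>) has to be rewritten as a nonnegative real exponent.\<close>

definition log_pgf :: "nat \<Rightarrow> real \<Rightarrow> exc \<Rightarrow> real" where
  "log_pgf n \<theta> w = - ln (enn2real (pgf n (ennreal (exp (- \<theta>))) (exc_span w)))"

lemma
  assumes "0 < \<theta>"
  shows exp_log_pgf: "ennreal (exp (- log_pgf n \<theta> w)) = pgf n (ennreal (exp (- \<theta>))) (exc_span w)"
    and log_pgf_nonneg: "0 \<le> log_pgf n \<theta> w"
proof -
  let ?z = "ennreal (exp (- \<theta>))"
  have z: "0 < ?z" "?z \<le> 1"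
    using assms by auto
  obtain p where p: "pgf n ?z (exc_span w) = ennreal p" "0 \<le> p"
    using pgf_le_1[OF z(2), of n "exc_span w"] by (cases "pgf n ?z (exc_span w)") (auto simp: top_unique)
  then have "0 < p" "p \<le> 1"
    using pgf_pos[OF z, of n "exc_span w"] pgf_le_1[OF z(2), of n "exc_span w"] by auto
  then show "ennreal (exp (- log_pgf n \<theta> w)) = pgf n ?z (exc_span w)" "0 \<le> log_pgf n \<theta> w"
    by (auto simp: log_pgf_def p)
qed

lemma log_pgf_measurable [measurable]: "log_pgf n \<theta> \<in> borel_measurable exc_M"
  unfolding log_pgf_def[abs_def] by measurable

text \<open>The kernel term is what the Laplace functional leaves on the parents when the children
  carry the exponent of index n; the other term is the parent's own weight if it is alive.\<close>

lemma log_pgf_Suc: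
  assumes "0 < \<theta>"
  shows "ennreal (log_pgf (Suc n) \<theta> w) =
    ennreal \<theta> * of_bool (is_alive (exc_span w)) + kern_int a Q w (\<lambda>v. ennreal (1 - exp (- log_pgf n \<theta> v)))"
proof -
  let ?z = "ennreal (exp (- \<theta>))"
  have z: "?z \<le> 1"
    using assms by auto
  have "ennreal (1 - exp (- log_pgf n \<theta> v)) = 1 - pgf n ?z (exc_span v)" for v
    using assms by (simp add: ennreal_minus flip: exp_log_pgf ennreal_1)
  then have "kern_int a Q w (\<lambda>v. ennreal (1 - exp (- log_pgf n \<theta> v))) = kern (\<lambda>v. 1 - pgf n ?z v) (exc_span w)"
    using kern_int_exc_span[OF ito intensity_pos, of "\<lambda>v. 1 - pgf n ?z v" w] by simp
  moreover have "kern (\<lambda>v. 1 - pgf n ?z v) (exc_span w) < \<infinity>"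
    using z by (intro kern_finite pgf_defect_le)
  moreover obtain \<kappa> where \<kappa>: "kern (\<lambda>v. 1 - pgf n ?z v) (exc_span w) = ennreal \<kappa>" "0 \<le> \<kappa>"
    using calculation(2) by (cases "kern (\<lambda>v. 1 - pgf n ?z v) (exc_span w)") auto
  moreover have "ennreal (exp (- log_pgf (Suc n) \<theta> w)) = ennreal (exp (- (\<theta> * of_bool (is_alive (exc_span w)) + \<kappa>)))"
    unfolding exp_log_pgf[OF assms] pgf_Suc_below_1[OF z] \<kappa>(1) enexp_neg_ennreal[OF \<kappa>(2)]
    by (simp add: exp_diff exp_minus divide_inverse ennreal_mult)
  then have "log_pgf (Suc n) \<theta> w = \<theta> * of_bool (is_alive (exc_span w)) + \<kappa>"
    by simp
  ultimately show ?thesis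
    using assms by (simp add: ennreal_plus)
qed

text \<open>Generation n + 1 is integrated out given its past, which moves its exponent to
  generation n as a kernel term. Splitting the living particles of generation n off the population
  then completes this term to the exponent of index j + 1.\<close>

lemma population_step:
  assumes "0 < \<theta>"
  shows "(\<integral>\<^sup>+ \<omega>. enexp_neg (ennreal \<theta> * population (Suc n) \<omega>) * enexp_neg (cint_Exc (Suc n) (\<lambda>w. ennreal (log_pgf j \<theta> w)) \<omega>) \<partial>M)
    = (\<integral>\<^sup>+ \<omega>. enexp_neg (ennreal \<theta> * population n \<omega>) * enexp_neg (cint_Exc n (\<lambda>w. ennreal (log_pgf (Suc j) \<theta> w)) \<omega>) \<partial>M)"
proof -
  let ?g = "\<lambda>w. ennreal (log_pgf j \<theta> w)"
  let ?\<kappa> = "\<lambda>w. kern_int a Q w (\<lambda>v. ennreal (1 - exp (- log_pgf j \<theta> v)))"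
  have "?\<kappa> = (\<lambda>w. kern (\<lambda>v. 1 - pgf j (ennreal (exp (- \<theta>))) v) (exc_span w))"
    using assms kern_int_exc_span[OF ito intensity_pos, of "\<lambda>v. 1 - pgf j (ennreal (exp (- \<theta>))) v"]
    by (simp add: ennreal_minus flip: exp_log_pgf ennreal_1)
  also have "\<dots> \<in> borel_measurable exc_M"
    by measurable
  finally have \<kappa> [measurable]: "?\<kappa> \<in> borel_measurable exc_M" .
  have "(\<integral>\<^sup>+ \<omega>. enexp_neg (ennreal \<theta> * population (Suc n) \<omega>) * enexp_neg (cint_Exc (Suc n) ?g \<omega>) \<partial>M) =
     (\<integral>\<^sup>+ \<omega>. enexp_neg (ennreal \<theta> * population (Suc n) \<omega>) * enexp_neg (cint_Exc n ?\<kappa> \<omega>) \<partial>M)"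
  proof (rule nn_integral_weighted_eq[OF subalgebra_history[of "Suc n"]])
    fix E assume E: "E \<in> sets (history (Suc n))"
    have "(\<integral>\<^sup>+\<omega>. indicator E \<omega> * enexp_neg (cint_Exc (Suc n) ?g \<omega>) \<partial>M)
       = (\<integral>\<^sup>+\<omega>. indicator E \<omega> * enexp_neg (cint (N (Suc n) \<omega>) ?g) \<partial>M)"
      using cint_Exc_AE_eq[of ?g ?g "Suc n"] by (intro nn_integral_cong_AE) auto
    also have "\<dots> = (\<integral>\<^sup>+\<omega>. indicator E \<omega> * enexp_neg (cint (N n \<omega>) ?\<kappa>) \<partial>M)"
      using E assms by (intro laplace_functional) (auto simp: sets_history log_pgf_nonneg)
    also have "\<dots> = (\<integral>\<^sup>+\<omega>. indicator E \<omega> * enexp_neg (cint_Exc n ?\<kappa> \<omega>) \<partial>M)"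
      using cint_Exc_AE_eq[of ?\<kappa> ?\<kappa> n] by (intro nn_integral_cong_AE) auto
    finally show "(\<integral>\<^sup>+\<omega>. indicator E \<omega> * enexp_neg (cint_Exc (Suc n) ?g \<omega>) \<partial>M)
       = (\<integral>\<^sup>+\<omega>. indicator E \<omega> * enexp_neg (cint_Exc n ?\<kappa> \<omega>) \<partial>M)" .
  next
    \<comment> \<open>\<open>population (Suc n)\<close> counts generations 0 to n, exactly those
      that generate \<open>history (Suc n)\<close>.\<close>
    show "(\<lambda>\<omega>. enexp_neg (ennreal \<theta> * population (Suc n) \<omega>)) \<in> borel_measurable (history (Suc n))"
      using population_measurable_history[of "Suc n"] by measurable
  qed measurable
  also have "\<dots> = (\<integral>\<^sup>+ \<omega>. enexp_neg (ennreal \<theta> * population n \<omega>) * enexp_neg (cint_Exc n (\<lambda>w. ennreal (log_pgf (Suc j) \<theta> w)) \<omega>) \<partial>M)"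
  proof (intro nn_integral_cong)
    fix \<omega>
    have "(\<lambda>w. ennreal (log_pgf (Suc j) \<theta> w) * indicator Exc w) = (\<lambda>w. ennreal \<theta> * indicator alive_set w + ?\<kappa> w * indicator Exc w)"
      unfolding log_pgf_Suc[OF assms] by (auto simp: fun_eq_iff alive_set_def indicator_def)
    then have "cint_Exc n (\<lambda>w. ennreal (log_pgf (Suc j) \<theta> w)) \<omega> = ennreal \<theta> * cnt (N n \<omega>) alive_set + cint_Exc n ?\<kappa> \<omega>"
      by (simp add: cint_Exc_def cint_add cint_cmult cnt_def)
    then show "enexp_neg (ennreal \<theta> * population (Suc n) \<omega>) * enexp_neg (cint_Exc n ?\<kappa> \<omega>)
       = enexp_neg (ennreal \<theta> * population n \<omega>) * enexp_neg (cint_Exc n (\<lambda>w. ennreal (log_pgf (Suc j) \<theta> w)) \<omega>)"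
      by (simp add: population_def distrib_left enexp_neg_add mult.assoc)
  qed
  finally show ?thesis .
qed

text \<open>Gives a measurable stand-in for a function of the initial particle, which is not known
  to be a measurable map itself.\<close>

lemma AE_cint_root: "AE \<omega> in M. cint_Exc 0 f \<omega> = f (root \<omega>)"
  using AE_root_in_Exc AE_space
  by eventually_elim (simp add: cint_Exc_def N_0 cint_single)

lemma population_laplace:
  assumes "0 < \<theta>"
  shows "(\<integral>\<^sup>+ \<omega>. enexp_neg (ennreal \<theta> * population n \<omega>) \<partial>M)
    = (\<integral>\<^sup>+ \<omega>. cint_Exc 0 (\<lambda>w. pgf n (ennreal (exp (- \<theta>))) (exc_span w)) \<omega> \<partial>M)"
proof -
  \<comment> \<open>Each step lowers the generation and raises the index by one, so j + m is
    preserved; the case j = 0 starts from exponent 0 because \<open>pgf 0\<close> is 1.\<close>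
  have *: "(\<integral>\<^sup>+ \<omega>. enexp_neg (ennreal \<theta> * population m \<omega>) * enexp_neg (cint_Exc m (\<lambda>w. ennreal (log_pgf j \<theta> w)) \<omega>) \<partial>M)
     = (\<integral>\<^sup>+ \<omega>. enexp_neg (cint_Exc 0 (\<lambda>w. ennreal (log_pgf (j + m) \<theta> w)) \<omega>) \<partial>M)" for m j
  proof (induction m arbitrary: j)
    case 0
    then show ?case
      by (simp add: population_def)
  next
    case (Suc m)
    show ?case
      unfolding population_step[OF assms] Suc by simp
  qed
  have "(\<integral>\<^sup>+ \<omega>. enexp_neg (ennreal \<theta> * population n \<omega>) \<partial>M)
    = (\<integral>\<^sup>+ \<omega>. enexp_neg (cint_Exc 0 (\<lambda>w. ennreal (log_pgf n \<theta> w)) \<omega>) \<partial>M)"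
    using *[of n 0] by (simp add: log_pgf_def cint_Exc_def cint_def)
  also have "\<dots> = (\<integral>\<^sup>+ \<omega>. cint_Exc 0 (\<lambda>w. pgf n (ennreal (exp (- \<theta>))) (exc_span w)) \<omega> \<partial>M)"
  proof (rule nn_integral_cong_AE)
    show "AE \<omega> in M. enexp_neg (cint_Exc 0 (\<lambda>w. ennreal (log_pgf n \<theta> w)) \<omega>)
        = cint_Exc 0 (\<lambda>w. pgf n (ennreal (exp (- \<theta>))) (exc_span w)) \<omega>"
      using AE_cint_root[of "\<lambda>w. ennreal (log_pgf n \<theta> w)"]
        AE_cint_root[of "\<lambda>w. pgf n (ennreal (exp (- \<theta>))) (exc_span w)"]
    proof eventually_elim
      case (elim \<omega>)
      show ?case
        unfolding elim by (simp add: enexp_neg_ennreal log_pgf_nonneg exp_log_pgf assms)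
    qed
  qed
  finally show ?thesis .
qed

end

section \<open>From Laplace transforms to exponential moments\<close>

context brownian_fan
begin

lemma population_nat_or_top: "population n \<omega> = \<infinity> \<or> (\<exists>k::nat. population n \<omega> = of_nat k)"
  unfolding population_def by (rule nat_or_top_sum) (rule cnt_nat_or_top)

text \<open>p is the law of the population on the naturals, q the expected coefficients of the
  generating function at the initial particle. Both series agree on (0,1) by
  \<open>population_laplace\<close>, so p = q, and the two sides can be evaluated at exp l >
  1.\<close>

lemma population_exp_moment:
  assumes "0 < l"
  shows "(\<integral>\<^sup>+ \<omega>. enexp_pos l (population n \<omega>) \<partial>M) = (\<integral>\<^sup>+ \<omega>. pgf n (ennreal (exp l)) (exc_span (root \<omega>)) \<partial>M)"
proof -
  obtain c where c [measurable]: "\<And>k. c k \<in> borel_measurable SE" and pgf: "\<And>z w. pgf n z w = (\<Sum>k. c k w * z ^ k)"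
    using pos_power_series_pgf[of n] by (auto simp: pos_power_series_def)
  define q where "q k = (\<integral>\<^sup>+ \<omega>. cint_Exc 0 (\<lambda>w. c k (exc_span w)) \<omega> \<partial>M)" for k
  define p where "p k = emeasure M {\<omega> \<in> space M. population n \<omega> = of_nat k}" for k
  have root_pgf: "(\<integral>\<^sup>+ \<omega>. pgf n z (exc_span (root \<omega>)) \<partial>M) = (\<Sum>k. q k * z ^ k)" for z
  proof -
    have "AE \<omega> in M. \<forall>k. cint_Exc 0 (\<lambda>w. c k (exc_span w)) \<omega> = c k (exc_span (root \<omega>))"
      unfolding AE_all_countable by (intro allI AE_cint_root)
    then have "AE \<omega> in M. pgf n z (exc_span (root \<omega>)) = (\<Sum>k. cint_Exc 0 (\<lambda>w. c k (exc_span w)) \<omega> * z ^ k)"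
      by eventually_elim (simp add: pgf)
    then have "(\<integral>\<^sup>+ \<omega>. pgf n z (exc_span (root \<omega>)) \<partial>M) = (\<integral>\<^sup>+ \<omega>. (\<Sum>k. cint_Exc 0 (\<lambda>w. c k (exc_span w)) \<omega> * z ^ k) \<partial>M)"
      by (rule nn_integral_cong_AE)
    also have "\<dots> = (\<Sum>k. q k * z ^ k)"
      unfolding q_def by (subst nn_integral_suminf) (auto simp: nn_integral_multc)
    finally show ?thesis .
  qed
  have population_sum: "(\<integral>\<^sup>+ \<omega>. (\<Sum>k. of_bool (population n \<omega> = of_nat k) * z ^ k) \<partial>M) = (\<Sum>k. p k * z ^ k)" for z :: ennreal
  proof -
    have "(\<integral>\<^sup>+ \<omega>. of_bool (population n \<omega> = of_nat k) * z ^ k \<partial>M) = p k * z ^ k" for k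
    proof -
      have "(\<integral>\<^sup>+ \<omega>. of_bool (population n \<omega> = of_nat k) * z ^ k \<partial>M)
         = (\<integral>\<^sup>+ \<omega>. z ^ k * indicator {\<omega> \<in> space M. population n \<omega> = of_nat k} \<omega> \<partial>M)"
        by (intro nn_integral_cong) (auto simp: indicator_def)
      then show ?thesis
        unfolding p_def by (simp add: nn_integral_cmult_indicator mult.commute)
    qed
    then show ?thesis
      by (subst nn_integral_suminf) (auto simp: of_bool_def)
  qed
  have q_1: "(\<Sum>k. q k) = 1"
    using root_pgf[of 1] by (simp add: pgf_at_1 emeasure_space_1)
  have pq: "p k = q k" for k
  proof (rule power_series_unique_ennreal)
    show "p k \<le> 1" for k
      unfolding p_def by (rule emeasure_le_1)
    show "q k \<le> 1" for k
      using sum_le_suminf[of q "{k}"] by (simp add: q_1)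
    fix z :: real assume z: "0 < z" "z < 1"
    define \<theta> where "\<theta> = - ln z"
    have \<theta>: "0 < \<theta>" "exp (- \<theta>) = z"
      using z by (auto simp: \<theta>_def)
    have "enexp_neg (ennreal \<theta> * population n \<omega>) = (\<Sum>k. of_bool (population n \<omega> = of_nat k) * ennreal z ^ k)" for \<omega>
    proof -
      consider "population n \<omega> = \<infinity>" | m :: nat where "population n \<omega> = of_nat m"
        using population_nat_or_top by blast
      then show ?thesis
      proof cases
        case 1
        then show ?thesis
          using \<theta> by (simp add: enexp_neg_def ennreal_mult_top)
      next
        case 2
        show ?thesis
          unfolding 2 using \<theta> by (simp only: suminf_of_bool_power enexp_neg_nat less_imp_le)
      qed
    qed
    then have "(\<Sum>k. p k * ennreal z ^ k) = (\<integral>\<^sup>+ \<omega>. enexp_neg (ennreal \<theta> * population n \<omega>) \<partial>M)"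
      by (simp add: population_sum)
    also have "\<dots> = (\<integral>\<^sup>+ \<omega>. cint_Exc 0 (\<lambda>w. pgf n (ennreal z) (exc_span w)) \<omega> \<partial>M)"
      using population_laplace[OF \<theta>(1)] by (simp add: \<theta>(2))
    also have "\<dots> = (\<integral>\<^sup>+ \<omega>. pgf n (ennreal z) (exc_span (root \<omega>)) \<partial>M)"
      by (intro nn_integral_cong_AE AE_cint_root)
    finally show "(\<Sum>k. p k * ennreal z ^ k) = (\<Sum>k. q k * ennreal z ^ k)"
      by (simp add: root_pgf)
  qed
  \<comment> \<open>The sum is 1 or 0 according to whether the population is finite or infinite. An
    infinite value would be invisible in the power series, yet would make the exponential moment
    infinite.\<close>
  have "AE \<omega> in M. (\<Sum>k. of_bool (population n \<omega> = of_nat k) * 1 ^ k) = (1::ennreal)"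
  proof (rule AE_eq_1_if_nn_integral_eq_1[OF prob_space_axioms])
    show "(\<Sum>k. of_bool (population n \<omega> = of_nat k) * 1 ^ k) \<le> (1::ennreal)" for \<omega>
      using population_nat_or_top[of n \<omega>] suminf_of_bool_power[of _ 1] by auto
    show "(\<integral>\<^sup>+ \<omega>. (\<Sum>k. of_bool (population n \<omega> = of_nat k) * 1 ^ k) \<partial>M) = 1"
      using q_1 by (simp add: population_sum pq del: power_one mult_1_right) simp
  qed
  then have "AE \<omega> in M. enexp_pos l (population n \<omega>) = (\<Sum>k. of_bool (population n \<omega> = of_nat k) * ennreal (exp l) ^ k)"
  proof eventually_elim
    case (elim \<omega>)
    then have "population n \<omega> \<noteq> \<infinity>"
      by auto
    then obtain m :: nat where m: "population n \<omega> = of_nat m"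
      using population_nat_or_top by blast
    show ?case
      unfolding m by (simp only: suminf_of_bool_power enexp_pos_nat)
  qed
  then have "(\<integral>\<^sup>+ \<omega>. enexp_pos l (population n \<omega>) \<partial>M) = (\<Sum>k. p k * ennreal (exp l) ^ k)"
    unfolding population_sum[symmetric] by (rule nn_integral_cong_AE)
  then show ?thesis
    by (simp add: pq root_pgf)
qed

lemma AE_alive_eq_SUP: "AE \<omega> in M. alive N \<omega> t = (SUP n. population n \<omega>)"
proof -
  have "AE \<omega> in M. \<forall>n. cnt (N n \<omega>) (- Exc) = 0"
    unfolding AE_all_countable by (intro allI AE_cnt_compl_Exc)
  then show ?thesis
  proof eventually_elim
    case (elim \<omega>)
    have "cnt (N n \<omega>) {w. ereal (exc_start w) < ereal t \<and> ereal t < exc_end w} = cnt (N n \<omega>) alive_set" for n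
      unfolding cnt_def
      by (rule cint_cong_off_null[OF elim[rule_format, of n]])
         (auto simp: alive_set_def is_alive_def exc_span_def indicator_def)
    then show ?case
      by (simp add: alive_def population_def suminf_eq_SUP)
  qed
qed

text \<open>Continuity of the exponential settles a finite supremum; for an infinite one the linear
  lower bound l y \<le> exp (l y) forces divergence.\<close>

lemma enexp_pos_SUP:
  fixes x :: "nat \<Rightarrow> ennreal"
  assumes "0 < l" "incseq x"
  shows "enexp_pos l (SUP n. x n) = (SUP n. enexp_pos l (x n))"
proof (cases "(SUP n. x n) = \<infinity>")
  case True
  have "ennreal l * y \<le> enexp_pos l y" for y
  proof (cases y)
    case (real r)
    have "l * r \<le> exp (l * r)"
      using exp_ge_add_one_self[of "l * r"] by linarith
    then show ?thesis
      using real assms(1) by (simp add: enexp_pos_ennreal ennreal_leI flip: ennreal_mult)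
  qed (simp add: enexp_pos_def)
  then have "(SUP n. ennreal l * x n) \<le> (SUP n. enexp_pos l (x n))"
    by (intro SUP_mono) auto
  moreover have "(SUP n. ennreal l * x n) = \<infinity>"
    unfolding SUP_mult_left_ennreal[symmetric] True using assms(1) by (simp add: ennreal_mult_top)
  ultimately have "(SUP n. enexp_pos l (x n)) = \<infinity>"
    by (simp only: infinity_ennreal_def top_unique)
  then show ?thesis
    unfolding True by (simp only: enexp_pos_def refl if_True)
next
  case False
  define S where "S = (SUP n. x n)"
  have S: "S < \<infinity>"
    unfolding S_def using False by (simp only: infinity_ennreal_def less_top not_False_eq_True)
  have fin: "x n < \<infinity>" for n
    using S SUP_upper[of n UNIV x] by (simp add: S_def[symmetric] le_less_trans)
  have "x \<longlonglongrightarrow> S"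
    unfolding S_def using assms(2) by (rule LIMSEQ_SUP)
  then have "(\<lambda>n. enn2real (x n)) \<longlonglongrightarrow> enn2real S"
    using S by (intro tendsto_enn2real) auto
  then have "(\<lambda>n. ennreal (exp (l * enn2real (x n)))) \<longlonglongrightarrow> ennreal (exp (l * enn2real S))"
    by (intro tendsto_ennrealI tendsto_exp tendsto_mult tendsto_const)
  then have "(\<lambda>n. enexp_pos l (x n)) \<longlonglongrightarrow> enexp_pos l (SUP n. x n)"
    unfolding S_def[symmetric] using S[THEN less_imp_neq] fin[THEN less_imp_neq] by (simp add: enexp_pos_def)
  moreover have "incseq (\<lambda>n. enexp_pos l (x n))"
    using assms by (auto simp: incseq_def intro!: enexp_pos_mono)
  ultimately show ?thesis
    using LIMSEQ_SUP LIMSEQ_unique by blast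
qed

text \<open>The bound on \<open>pgf n\<close> at the initial particle is uniform in n, so monotone
  convergence over the number of generations applies; exp 1 comes from l * \<open>dominating\<close>
  \<le> 1.\<close>

lemma alive_exp_moment_le:
  assumes "0 < l" and small: "\<And>w. 0 \<le> fst w \<Longrightarrow> ennreal l * dominating w \<le> 1"
  shows "(\<integral>\<^sup>+ \<omega>. enexp_pos l (alive N \<omega> t) \<partial>M) \<le> ennreal (exp 1)"
proof -
  have incseq: "incseq (\<lambda>n. population n \<omega>)" for \<omega>
    by (auto simp: incseq_def population_def intro!: sum_mono2)
  have "(\<integral>\<^sup>+ \<omega>. enexp_pos l (alive N \<omega> t) \<partial>M) = (\<integral>\<^sup>+ \<omega>. (SUP n. enexp_pos l (population n \<omega>)) \<partial>M)"
    using AE_alive_eq_SUP assms(1) incseq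
    by (intro nn_integral_cong_AE) (auto simp: enexp_pos_SUP)
  also have "\<dots> = (SUP n. \<integral>\<^sup>+ \<omega>. enexp_pos l (population n \<omega>) \<partial>M)"
    using incseq assms(1)
    by (intro nn_integral_monotone_convergence_SUP)
       (auto simp: incseq_def le_fun_def intro!: enexp_pos_mono)
  also have "\<dots> \<le> ennreal (exp 1)"
  proof (intro SUP_least)
    fix n
    have "pgf n (ennreal (exp l)) (exc_span (root \<omega>)) \<le> ennreal (exp 1)" for \<omega>
    proof -
      have 0: "0 \<le> fst (exc_span (root \<omega>))"
        by (simp add: exc_span_def kill_def exc_start_def)
      have "pgf n (ennreal (exp l)) (exc_span (root \<omega>)) \<le> enexp_pos 1 (ennreal l * dominating (exc_span (root \<omega>)))"
        using assms(1) by (intro pgf_exp_le small 0) auto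
      also have "\<dots> \<le> enexp_pos 1 1"
        by (intro enexp_pos_mono small 0) auto
      finally show ?thesis
        by (simp add: enexp_pos_def)
    qed
    then have "(\<integral>\<^sup>+ \<omega>. pgf n (ennreal (exp l)) (exc_span (root \<omega>)) \<partial>M) \<le> (\<integral>\<^sup>+ \<omega>. ennreal (exp 1) \<partial>M)"
      by (intro nn_integral_mono)
    then show "(\<integral>\<^sup>+ \<omega>. enexp_pos l (population n \<omega>) \<partial>M) \<le> ennreal (exp 1)"
      by (simp add: population_exp_moment[OF assms(1)] emeasure_space_1)
  qed
  finally show ?thesis .
qed

end

theorem theorem2p14:
  fixes a :: real and Q :: "exc measure" and M :: "'o measure"
    and X :: "'o \<Rightarrow> real \<Rightarrow> real" and L :: "'o \<Rightarrow> real"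
    and N :: "nat \<Rightarrow> 'o \<Rightarrow> exc \<Rightarrow> nat"
  assumes "0 < a"
    and "is_ito Q"
    and "is_brownian_fan a Q M X L N"
  shows "\<exists>C::real. 0 < C \<and> (\<exists>lam::real \<Rightarrow> real.
           continuous_on {0..} lam \<and> (\<forall>t\<ge>0. 0 < lam t) \<and> antimono_on {0..} lam \<and>
           (\<forall>t>0. (\<integral>\<^sup>+ \<omega>. enexp_pos (lam t) (alive N \<omega> t) \<partial>M) \<le> ennreal C))"
proof -
  define \<alpha> where "\<alpha> = a * (2 / sqrt (2 * pi))"
  \<comment> \<open>The bound of \<open>dominating_le\<close> with s = 0 and \<alpha> = a D, where D
    is the tail constant of the lifetime. Then \<lambda> = 1 / B is the value that the smallness
    condition permits.\<close>
  define B where "B t = 1 + (2 * \<alpha> * sqrt t + 8 * \<alpha>\<^sup>2 * exp (36 * \<alpha>\<^sup>2 * t) * t)" for t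
  have \<alpha>: "0 < \<alpha>"
    using assms(1) by (simp add: \<alpha>_def)
  have B_ge_1: "1 \<le> B t" if "0 \<le> t" for t
    using that \<alpha> by (simp add: B_def)
  have B_mono: "B s \<le> B t" if "0 \<le> s" "s \<le> t" for s t
    unfolding B_def using that \<alpha> by (intro add_mono mult_mono) auto
  have "continuous_on {0..} (\<lambda>t. 1 / B t)"
    using B_ge_1 unfolding B_def by (intro continuous_intros) force
  moreover have "\<forall>t\<ge>0. 0 < 1 / B t"
    using B_ge_1 by (simp add: less_le_trans[OF zero_less_one])
  moreover have "antimono_on {0..} (\<lambda>t. 1 / B t)"
  proof (rule monotone_onI)
    fix s t :: real assume "s \<in> {0..}" "t \<in> {0..}" "s \<le> t"
    then show "1 / B t \<le> 1 / B s"
      using B_mono[of s t] B_ge_1[of s] by (intro divide_left_mono) auto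
  qed
  moreover have "(\<integral>\<^sup>+ \<omega>. enexp_pos (1 / B t) (alive N \<omega> t) \<partial>M) \<le> ennreal (exp 1)" if "0 < t" for t
  proof -
    interpret brownian_fan a Q M X L N t
      using assms by unfold_locales
    show ?thesis
    proof (rule alive_exp_moment_le)
      show "0 < 1 / B t"
        using B_ge_1[of t] that by simp
      fix w :: "real \<times> ereal" assume "0 \<le> fst w"
      then have "dominating w \<le> 1 + ennreal (2 * \<alpha> * sqrt t + 8 * \<alpha>\<^sup>2 * exp (36 * \<alpha>\<^sup>2 * t) * t)"
        using dominating_le[of 0 w] that by (simp add: \<alpha>_def)
      also have "\<dots> = ennreal (B t)"
        using that \<alpha> by (simp add: B_def ennreal_plus[of 1, symmetric] del: ennreal_plus flip: ennreal_1)
      finally have "ennreal (1 / B t) * dominating w \<le> ennreal (1 / B t) * ennreal (B t)"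
        by (rule mult_left_mono) simp
      also have "\<dots> = 1"
        using B_ge_1[of t] that by (simp flip: ennreal_mult)
      finally show "ennreal (1 / B t) * dominating w \<le> 1" .
    qed
  qed
  ultimately show ?thesis
    by (intro exI[of _ "exp 1"] conjI exI[of _ "\<lambda>t. 1 / B t"]) auto
qed

end
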